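(* Let $d\le m$ be positive integers, let $f:\mathbb{R}_{\geq 0}\to\mathbb{R}_{\geq 0}$ be a non-decreasing strictly convex function, and write $P_f(S)=\operatorname{tr}(f(S))$ for positive semidefinite $S\in\mathcal{M}_d(\mathbb{C})$ and $P_f(\mathcal{F})=P_f(S^{\mathcal{F}})$ for $\mathcal{F}=\{\phi_i\}_{i=1}^m\subset\mathbb{C}^d$. Let $c>0$ and let $\mathbf{a}=(a_i)_{i=1}^m$ be a non-increasing finite sequence of positive real numbers. Then: (a) Every local minimizer of $P_f$ in $\mathcal{A}(c)$ with respect to the distance $d(\cdot,\cdot)$ is a tight frame for $\mathbb{C}^d$, and hence a global minimizer of $P_f$ in $\mathcal{A}(c)$. (b) If $\mathcal{F}\in\mathcal{B}(\mathbf{a})$ is such that $S^{\mathcal{F}}$ is a local minimizer of $P_f$ in $\mathcal{R}(\mathbf{a})$ with respect to the operator norm, then $\mathcal{F}$ is of the form $$\{\sqrt{a_i}\,e_i\}_{i=1}^r\cup\{\phi_i\}_{i=r+1}^m$$ for some orthonormal basis $\{e_i\}_{i=1}^d$ of $\mathbb{C}^d$, where $r=r_d(\mathbf{a})$ is the $d$-irregularity of $\mathbf{a}$ and $\{\phi_i\}_{i=r+1}^m$ is a tight frame for $\operatorname{span}\{e_i\}_{i=r+1}^d$; hence $S^{\mathcal{F}}$ is a global minimizer of $P_f$ in $\mathcal{R}(\mathbf{a})$.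
   Context: For a finite sequence $\mathcal{F}=\{\phi_i\}_{i=1}^m\subset\mathbb{C}^d$, the synthesis operator is $T^{\mathcal{F}}:\mathbb{C}^m\to\mathbb{C}^d$, sending the $i$-th canonical basis vector to $\phi_i$, and the frame operator is $S^{\mathcal{F}}=T^{\mathcal{F}}(T^{\mathcal{F}})^*$. The matrix $f(S)$ is defined by functional calculus, so $\operatorname{tr} f(S)=\sum_{i=1}^d f(\lambda_i)$ with $\lambda_i$ the eigenvalues of $S$ counted with multiplicity. A sequence $\{\phi_i\}_i$ in a subspace $W$ is a tight frame for $W$ if there is $\alpha>0$ with $\sum_i|\langle x,\phi_i\rangle|^2=\alpha\|x\|^2$ for all $x\in W$. $\mathcal{A}(c)=\{\{\phi_i\}_{i=1}^m\subset\mathbb{C}^d:\ \sum_{i=1}^m\|\phi_i\|^2=c\}$; $\mathcal{B}(\mathbf{a})=\{\{\phi_i\}_{i=1}^m\subset\mathbb{C}^d:\ \|\phi_i\|^2=a_i\text{ for every }i\}$; $\mathcal{R}(\mathbf{a})=\{S^{\mathcal{F}}:\ \mathcal{F}\in\mathcal{B}(\mathbf{a})\}$. The vector-vector distance between $\mathcal{F}=\{\phi_i\}_{i=1}^m$ and $\mathcal{G}=\{\psi_i\}_{i=1}^m$ is $d(\mathcal{F},\mathcal{G})=\max_{1\le i\le m}\|\phi_i-\psi_i\|$. The $d$-irregularity of a non-increasing positive sequence $\mathbf{a}=(a_i)_{i=1}^m$, $d\le m$, is $r_d(\mathbf{a})=\max\{1\le j\le d-1:\ (d-j)a_j>\sum_{i=j+1}^m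 a_i\}$ if this set is nonempty, and $r_d(\mathbf{a})=0$ otherwise. *)

theory Defs
  imports "HOL-Analysis.Analysis"
begin

text \<open>
  The space \<open>\<complex>\<^sup>d\<close> is the type \<^typ>\<open>complex^'n\<close> with \<open>d = CARD('n)\<close>; its library norm is
  the Euclidean norm. A finite sequence \<open>(\<phi>\<^sub>i)\<close>, \<open>1 \<le> i \<le> m\<close>, is a function on \<^typ>\<open>nat\<close> of
  which only the values on \<open>{1..m}\<close> are ever used. The library inner product on
  \<^typ>\<open>complex^'n\<close> is the real part of the Hermitian one, and the library \<open>span\<close> is the real
  span, so the Hermitian product is defined here and complex spans are written \<open>vec.span\<close>.
\<close>

subsection \<open>Complex linear algebra\<close>

definition cinner :: "complex^'n \<Rightarrow> complex^'n \<Rightarrow> complex" where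
  "cinner x y = (\<Sum>k\<in>UNIV. x $ k * cnj (y $ k))"

definition cadjoint :: "complex^'n^'m \<Rightarrow> complex^'m^'n" where
  "cadjoint A = (\<chi> i j. cnj (A $ j $ i))"

definition unitary_matrix :: "complex^'n^'n \<Rightarrow> bool" where
  "unitary_matrix U \<longleftrightarrow> cadjoint U ** U = mat 1 \<and> U ** cadjoint U = mat 1"

definition real_diag :: "('n \<Rightarrow> real) \<Rightarrow> complex^'n^'n" where
  "real_diag l = (\<chi> i j. if i = j then complex_of_real (l i) else 0)"

definition orthonormal_basis :: "(nat \<Rightarrow> complex^'n) \<Rightarrow> bool" where
  "orthonormal_basis e \<longleftrightarrow>
     (\<forall>i\<in>{1..CARD('n)}. \<forall>j\<in>{1..CARD('n)}. cinner (e i) (e j) = (if i = j then 1 else 0)) \<and>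
     vec.span (e ` {1..CARD('n)}) = UNIV"

text \<open>
  Functional calculus of a Hermitian matrix. By the spectral theorem a unitary
  diagonalization exists, and \<open>matrix_fun_unique\<close> shows that the value does not depend on it.
\<close>

definition matrix_fun :: "(real \<Rightarrow> real) \<Rightarrow> complex^'n^'n \<Rightarrow> complex^'n^'n" where
  "matrix_fun f S = (THE B. \<exists>U l. unitary_matrix U \<and> S = U ** real_diag l ** cadjoint U \<and>
     B = U ** real_diag (\<lambda>i. f (l i)) ** cadjoint U)"

lemma real_diag_intertwine:
  fixes W :: "complex^'n^'n"
  assumes "W ** real_diag l = real_diag k ** W"
  shows "W ** real_diag (\<lambda>i. f (l i)) = real_diag (\<lambda>i. f (k i)) ** W"
proof -
  have R: "(W ** real_diag g) $ i $ j = W $ i $ j * of_real (g j)" for g i j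
    by (simp add: matrix_matrix_mult_def real_diag_def if_distrib cong: if_cong)
  have L: "(real_diag g ** W) $ i $ j = of_real (g i) * W $ i $ j" for g i j
    by (simp add: matrix_matrix_mult_def real_diag_def if_distrib if_distribR cong: if_cong)
  have "W $ i $ j = 0 \<or> l j = k i" for i j
  proof -
    have "W $ i $ j * of_real (l j) = of_real (k i) * W $ i $ j"
      using R[of l i j] L[of k i j] unfolding assms by (rule trans[OF sym])
    then show ?thesis by (metis mult.commute mult_cancel_left of_real_eq_iff)
  qed
  then have "W $ i $ j * of_real (f (l j)) = of_real (f (k i)) * W $ i $ j" for i j
    by (metis mult.commute mult_zero_left)
  then show ?thesis by (simp add: vec_eq_iff R L)
qed

lemma matrix_fun_unique:
  fixes U V :: "complex^'n^'n"
  assumes U: "unitary_matrix U" and V: "unitary_matrix V"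
    and eq: "U ** real_diag l ** cadjoint U = V ** real_diag k ** cadjoint V"
  shows "U ** real_diag (\<lambda>i. f (l i)) ** cadjoint U = V ** real_diag (\<lambda>i. f (k i)) ** cadjoint V"
proof -
  have UU: "cadjoint U ** U = mat 1" "U ** cadjoint U = mat 1"
    and VV: "cadjoint V ** V = mat 1" "V ** cadjoint V = mat 1"
    using U V by (auto simp: unitary_matrix_def)
  have "cadjoint V ** (U ** real_diag l ** cadjoint U) ** U
      = cadjoint V ** (V ** real_diag k ** cadjoint V) ** U"
    using eq by simp
  then have "(cadjoint V ** U) ** real_diag l ** (cadjoint U ** U)
      = (cadjoint V ** V) ** real_diag k ** (cadjoint V ** U)"
    by (simp only: matrix_mul_assoc)
  then have "(cadjoint V ** U) ** real_diag l = real_diag k ** (cadjoint V ** U)"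
    by (simp add: UU VV)
  from real_diag_intertwine[OF this, of f]
  have "V ** ((cadjoint V ** U) ** real_diag (\<lambda>i. f (l i))) ** cadjoint U
      = V ** (real_diag (\<lambda>i. f (k i)) ** (cadjoint V ** U)) ** cadjoint U"
    by simp
  then have "(V ** cadjoint V) ** U ** real_diag (\<lambda>i. f (l i)) ** cadjoint U
      = V ** real_diag (\<lambda>i. f (k i)) ** cadjoint V ** (U ** cadjoint U)"
    by (simp only: matrix_mul_assoc)
  then show ?thesis by (simp add: UU VV)
qed

lemma matrix_fun_eq:
  fixes U :: "complex^'n^'n"
  assumes "unitary_matrix U" "S = U ** real_diag l ** cadjoint U"
  shows "matrix_fun f S = U ** real_diag (\<lambda>i. f (l i)) ** cadjoint U"
  unfolding matrix_fun_def
proof (rule the_equality)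
  fix B
  assume "\<exists>V k. unitary_matrix V \<and> S = V ** real_diag k ** cadjoint V \<and>
     B = V ** real_diag (\<lambda>i. f (k i)) ** cadjoint V"
  then show "B = U ** real_diag (\<lambda>i. f (l i)) ** cadjoint U"
    using assms matrix_fun_unique by metis
qed (use assms in blast)

text \<open>The trace \<open>tr (f S)\<close> is real by \<open>tr_fun_eq_sum\<close>; taking \<open>Re\<close> only adjusts the type.\<close>

definition tr_fun :: "(real \<Rightarrow> real) \<Rightarrow> complex^'n^'n \<Rightarrow> real" where
  "tr_fun f S = Re (trace (matrix_fun f S))"

lemma tr_fun_eq_sum:
  fixes U :: "complex^'n^'n"
  assumes U: "unitary_matrix U" and S: "S = U ** real_diag l ** cadjoint U"
  shows "trace (matrix_fun f S) = complex_of_real (\<Sum>i\<in>UNIV. f (l i))"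
    and "tr_fun f S = (\<Sum>i\<in>UNIV. f (l i))"
proof -
  have "trace (matrix_fun f S) = trace (cadjoint U ** (U ** real_diag (\<lambda>i. f (l i))))"
    unfolding matrix_fun_eq[OF U S] by (rule trace_mul_sym)
  also have "\<dots> = trace (real_diag (\<lambda>i. f (l i)))"
    using U by (simp add: matrix_mul_assoc unitary_matrix_def)
  finally show "trace (matrix_fun f S) = complex_of_real (\<Sum>i\<in>UNIV. f (l i))"
    by (simp add: trace_def real_diag_def)
  then show "tr_fun f S = (\<Sum>i\<in>UNIV. f (l i))"
    by (simp add: tr_fun_def)
qed

subsection \<open>Frames\<close>

definition synthesis :: "nat \<Rightarrow> (nat \<Rightarrow> complex^'n) \<Rightarrow> (nat \<Rightarrow> complex) \<Rightarrow> complex^'n" where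
  "synthesis m \<phi> c = (\<Sum>i=1..m. c i *s \<phi> i)"

definition analysis :: "nat \<Rightarrow> (nat \<Rightarrow> complex^'n) \<Rightarrow> complex^'n \<Rightarrow> (nat \<Rightarrow> complex)" where
  "analysis m \<phi> x = (\<lambda>i. if i \<in> {1..m} then cinner x (\<phi> i) else 0)"

text \<open>\<open>analysis m \<phi>\<close> is the adjoint \<open>T\<^sup>*\<close> of \<open>T = synthesis m \<phi>\<close>:\<close>

lemma analysis_adjoint_synthesis:
  "(\<Sum>i=1..m. analysis m \<phi> x i * cnj (c i)) = cinner x (synthesis m \<phi> c)"
proof -
  have "cinner x (synthesis m \<phi> c) = (\<Sum>k\<in>UNIV. \<Sum>i=1..m. x $ k * cnj (\<phi> i $ k) * cnj (c i))"
    by (simp add: cinner_def synthesis_def sum_distrib_left mult.commute mult.left_commute)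
  also have "\<dots> = (\<Sum>i=1..m. \<Sum>k\<in>UNIV. x $ k * cnj (\<phi> i $ k) * cnj (c i))"
    by (rule sum.swap)
  also have "\<dots> = (\<Sum>i=1..m. analysis m \<phi> x i * cnj (c i))"
    by (simp add: analysis_def cinner_def sum_distrib_right)
  finally show ?thesis by simp
qed

definition frame_operator :: "nat \<Rightarrow> (nat \<Rightarrow> complex^'n) \<Rightarrow> complex^'n^'n" where
  "frame_operator m \<phi> = matrix (synthesis m \<phi> \<circ> analysis m \<phi>)"

lemma frame_operator_mult:
  "frame_operator m \<phi> *v x = (\<Sum>i=1..m. cinner x (\<phi> i) *s \<phi> i)"
proof -
  have eq: "synthesis m \<phi> (analysis m \<phi> y) = (\<Sum>i=1..m. cinner y (\<phi> i) *s \<phi> i)" for y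
    by (simp add: synthesis_def analysis_def)
  have "Vector_Spaces.linear (*s) (*s) (synthesis m \<phi> \<circ> analysis m \<phi>)"
    by (intro Vector_Spaces.linear_iff[THEN iffD2] conjI allI vec.vector_space_axioms)
      (simp_all add: eq vec_eq_iff cinner_def sum.distrib sum_distrib_left sum_distrib_right
        algebra_simps)
  from matrix_works[OF this, of x] show ?thesis
    by (simp add: frame_operator_def eq)
qed

definition frame_potential :: "(real \<Rightarrow> real) \<Rightarrow> nat \<Rightarrow> (nat \<Rightarrow> complex^'n) \<Rightarrow> real" where
  "frame_potential f m \<phi> = tr_fun f (frame_operator m \<phi>)"

definition tight_frame_for :: "nat set \<Rightarrow> (nat \<Rightarrow> complex^'n) \<Rightarrow> (complex^'n) set \<Rightarrow> bool" where
  "tight_frame_for I \<phi> W \<longleftrightarrow> vec.subspace W \<and> (\<forall>i\<in>I. \<phi> i \<in> W) \<and>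
     (\<exists>\<alpha>>0. \<forall>x\<in>W. (\<Sum>i\<in>I. (cmod (cinner x (\<phi> i)))\<^sup>2) = \<alpha> * (norm x)\<^sup>2)"

definition frames_total :: "nat \<Rightarrow> real \<Rightarrow> (nat \<Rightarrow> complex^'n) set" where
  "frames_total m c = {\<phi>. (\<Sum>i=1..m. (norm (\<phi> i))\<^sup>2) = c}"

definition frames_norms :: "nat \<Rightarrow> (nat \<Rightarrow> real) \<Rightarrow> (nat \<Rightarrow> complex^'n) set" where
  "frames_norms m a = {\<phi>. \<forall>i\<in>{1..m}. (norm (\<phi> i))\<^sup>2 = a i}"

definition frame_operators_norms :: "nat \<Rightarrow> (nat \<Rightarrow> real) \<Rightarrow> (complex^'n^'n) set" where
  "frame_operators_norms m a = frame_operator m ` frames_norms m a"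

definition vector_vector_dist :: "nat \<Rightarrow> (nat \<Rightarrow> complex^'n) \<Rightarrow> (nat \<Rightarrow> complex^'n) \<Rightarrow> real" where
  "vector_vector_dist m \<phi> \<psi> = Max ((\<lambda>i. norm (\<phi> i - \<psi> i)) ` {1..m})"

definition operator_dist :: "complex^'n^'n \<Rightarrow> complex^'n^'n \<Rightarrow> real" where
  "operator_dist S T = onorm (\<lambda>x. (S - T) *v x)"

definition irregularity :: "nat \<Rightarrow> nat \<Rightarrow> (nat \<Rightarrow> real) \<Rightarrow> nat" where
  "irregularity d m a =
     (let J = {j \<in> {1..d - 1}. real (d - j) * a j > (\<Sum>i=j+1..m. a i)}
      in if J = {} then 0 else Max J)"

subsection \<open>Convexity and minimizers\<close>

definition strictly_convex_on :: "real set \<Rightarrow> (real \<Rightarrow> real) \<Rightarrow> bool" where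
  "strictly_convex_on I f \<longleftrightarrow> convex I \<and>
     (\<forall>x\<in>I. \<forall>y\<in>I. \<forall>t. x \<noteq> y \<and> 0 < t \<and> t < 1 \<longrightarrow>
        f ((1 - t) * x + t * y) < (1 - t) * f x + t * f y)"

definition global_minimizer :: "('a \<Rightarrow> real) \<Rightarrow> 'a set \<Rightarrow> 'a \<Rightarrow> bool" where
  "global_minimizer P X x \<longleftrightarrow> x \<in> X \<and> (\<forall>y\<in>X. P x \<le> P y)"

definition local_minimizer :: "('a \<Rightarrow> real) \<Rightarrow> 'a set \<Rightarrow> ('a \<Rightarrow> 'a \<Rightarrow> real) \<Rightarrow> 'a \<Rightarrow> bool" where
  "local_minimizer P X \<delta> x \<longleftrightarrow> x \<in> X \<and> (\<exists>\<epsilon>>0. \<forall>y\<in>X. \<delta> x y < \<epsilon> \<longrightarrow> P x \<le> P y)"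

end

theory Submission
  imports Defs
begin

text \<open>
  The potential of a frame \<open>\<phi>\<close> is the sum of \<open>f\<close> over the eigenvalues \<open>l 1 \<ge> \<dots> \<ge> l d\<close> of its
  frame operator, whose trace is the sum of the squared norms.

  Part (a). If two eigenvalues differ, they can be moved a little towards each other by a small
  change of the frame vectors (\<open>move_eigenvalues\<close>); this keeps the trace, and strict convexity
  makes the potential smaller. The delicate case is an eigenvalue 0 that has to be made
  positive: here \<open>m \<ge> d\<close> provides a linear dependency of the frame vectors, and with its
  coefficients they are pushed out of the hyperplane that contains them (\<open>increase_column\<close>).
  So at a local minimizer all eigenvalues are equal, which is tightness, and by convexity the
  constant spectrum is the best one with the given trace.

  Part (b). By the Schur-Horn theorem the operators in question are exactly those for which the
  partial sums of the eigenvalues dominate the partial sums of \<open>a\<close>, with equal totals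
  (\<open>sum_norms_le_sum_eigenvalues\<close> and \<open>frame_exists\<close>), and eigenvectors may be chosen freely.
  For a fixed orthonormal basis of eigenvectors these conditions are convex in the spectrum.
  The spectrum \<open>(a 1, \<dots>, a r, \<alpha>, \<dots>, \<alpha>)\<close>, where \<open>r\<close> is the irregularity, satisfies them, and
  by subgradients and summation by parts it has the strictly smallest potential
  (\<open>sum_optimal_less\<close>). If the spectrum of an operator is different, then the segment towards
  the optimal one consists of spectra of operators with the same prescribed norms, and the
  potential is smaller at once along it; so a local minimizer has the optimal spectrum
  (\<open>local_minimizer_optimal\<close>) and is a global one. Finally, equality in Ky Fan's inequality
  forces \<open>\<phi>\<^sub>1, \<dots>, \<phi>\<^sub>r\<close> to be orthogonal to each other and to all further frame vectors
  (\<open>phi_orthogonal\<close>), and on the orthogonal complement the operator is the scalar \<open>\<alpha>\<close>.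
\<close>

section \<open>The Hermitian inner product\<close>

lemma mult_cnj_cmod: "z * cnj z = (complex_of_real (cmod z))\<^sup>2"
    and cnj_mult_cmod: "cnj z * z = (complex_of_real (cmod z))\<^sup>2"
  by (simp_all add: mult.commute flip: complex_norm_square)

lemma cinner_add_left: "cinner (x + y) z = cinner x z + cinner y z"
  by (simp add: cinner_def sum.distrib distrib_right)

lemma cinner_add_right: "cinner x (y + z) = cinner x y + cinner x z"
  by (simp add: cinner_def sum.distrib distrib_left)

lemma cinner_diff_left: "cinner (x - y) z = cinner x z - cinner y z"
  by (simp add: cinner_def sum_subtractf left_diff_distrib)

lemma cinner_diff_right: "cinner x (y - z) = cinner x y - cinner x z"
  by (simp add: cinner_def sum_subtractf right_diff_distrib)

lemma cinner_scale_left: "cinner (c *s x) y = c * cinner x y"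
  by (simp add: cinner_def sum_distrib_left mult.assoc)

lemma cinner_scale_right: "cinner x (c *s y) = cnj c * cinner x y"
  by (simp add: cinner_def sum_distrib_left mult.assoc mult.left_commute)

lemma cinner_zero [simp]: "cinner 0 x = 0" "cinner x 0 = 0"
  by (simp_all add: cinner_def)

lemma cinner_sum_left: "cinner (\<Sum>i\<in>A. g i) y = (\<Sum>i\<in>A. cinner (g i) y)"
  by (induction A rule: infinite_finite_induct) (simp_all add: cinner_add_left)

lemma cinner_sum_right: "cinner y (\<Sum>i\<in>A. g i) = (\<Sum>i\<in>A. cinner y (g i))"
  by (induction A rule: infinite_finite_induct) (simp_all add: cinner_add_right)

lemma cnj_cinner: "cnj (cinner x y) = cinner y x"
  by (simp add: cinner_def mult.commute)

lemma cmod_cinner_commute: "cmod (cinner x y) = cmod (cinner y x)"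
  by (metis cnj_cinner complex_mod_cnj)

lemma cinner_self: "cinner x x = of_real ((norm x)\<^sup>2)"
proof -
  have "(norm x)\<^sup>2 = (\<Sum>k\<in>UNIV. (cmod (x $ k))\<^sup>2)"
    by (simp add: norm_vec_def L2_set_def sum_nonneg)
  then show ?thesis
    by (simp add: cinner_def mult_cnj_cmod)
qed

lemma cinner_mult_cnj: "cinner x y * cinner y x = of_real ((cmod (cinner x y))\<^sup>2)"
  using mult_cnj_cmod[of "cinner x y"] by (simp add: cnj_cinner)

lemma Re_cinner_self: "Re (cinner x x) = (norm x)\<^sup>2"
  by (simp add: cinner_self)

lemmas cinner_simps = cinner_add_left cinner_add_right cinner_diff_left cinner_diff_right
  cinner_scale_left cinner_scale_right

lemma scaleR_eq_scale: "r *\<^sub>R (x :: complex^'n) = complex_of_real r *s x"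
  by (simp add: vec_eq_iff scaleR_conv_of_real[where 'a = complex])

lemma norm_scale: "norm (c *s (x :: complex^'n)) = cmod c * norm x"
proof -
  have "(norm (c *s x))\<^sup>2 = Re ((c * cnj c) * cinner x x)"
    unfolding Re_cinner_self[symmetric] cinner_scale_left cinner_scale_right
    by (simp only: mult.assoc mult.left_commute)
  also have "\<dots> = (cmod c * norm x)\<^sup>2"
    by (simp add: mult_cnj_cmod cinner_self power_mult_distrib flip: of_real_mult of_real_power)
  finally show ?thesis by (simp add: power2_eq_iff_nonneg)
qed

lemma cinner_normalize:
  assumes "(norm x)\<^sup>2 = b" "0 < b"
  shows "cinner (complex_of_real (1 / sqrt b) *s x) (complex_of_real (1 / sqrt b) *s x) = 1"
proof -
  have "cinner (complex_of_real (1 / sqrt b) *s x) (complex_of_real (1 / sqrt b) *s x) =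
      of_real (1 / sqrt b) * (of_real (1 / sqrt b) * cinner x x)"
    by (simp only: cinner_scale_left cinner_scale_right complex_cnj_complex_of_real)
  also have "\<dots> = of_real (1 / sqrt b * (1 / sqrt b * b))"
    by (simp only: cinner_self assms(1) of_real_mult)
  also have "1 / sqrt b * (1 / sqrt b * b) = 1" using assms(2) by simp
  finally show ?thesis by simp
qed

definition orthonormal :: "nat \<Rightarrow> (nat \<Rightarrow> complex^'n) \<Rightarrow> bool" where
  "orthonormal k u \<longleftrightarrow> (\<forall>i\<in>{1..k}. \<forall>j\<in>{1..k}. cinner (u i) (u j) = (if i = j then 1 else 0))"

lemma orthonormalD:
  "orthonormal k u \<Longrightarrow> i \<in> {1..k} \<Longrightarrow> j \<in> {1..k} \<Longrightarrow> cinner (u i) (u j) = (if i = j then 1 else 0)"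
  by (simp add: orthonormal_def)

lemma orthonormal_norm:
  assumes "orthonormal k u" "i \<in> {1..k}"
  shows "norm (u i) = 1"
proof -
  have "Re (cinner (u i) (u i)) = 1"
    using orthonormalD[OF assms(1) assms(2) assms(2)] by simp
  then show ?thesis
    using power2_eq_iff_nonneg[of "norm (u i)" 1] by (simp add: Re_cinner_self)
qed

lemma cinner_orthonormal_sum:
  assumes "orthonormal k u" "j \<in> {1..k}"
  shows "cinner (\<Sum>i=1..k. c i *s u i) (u j) = c j"
proof -
  have "cinner (\<Sum>i=1..k. c i *s u i) (u j) = (\<Sum>i=1..k. if i = j then c i else 0)"
    unfolding cinner_sum_left cinner_scale_left
    by (rule sum.cong) (use assms(2) in \<open>auto simp: orthonormalD[OF assms(1)]\<close>)
  then show ?thesis using assms(2) by simp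
qed

lemma orthonormal_snoc:
  assumes "orthonormal k u" "norm x = 1" "\<And>j. j \<in> {1..k} \<Longrightarrow> cinner x (u j) = 0"
  shows "orthonormal (Suc k) (u(Suc k := x))"
proof -
  have "cinner (u j) x = 0" if "j \<in> {1..k}" for j
    using assms(3)[OF that] cnj_cinner[of x "u j"] by simp
  moreover have "cinner x x = 1" using assms(2) by (simp add: cinner_self)
  ultimately show ?thesis
    using assms(1,3) by (auto simp: orthonormal_def le_Suc_eq)
qed

text \<open>Bessel's inequality is \<open>\<parallel>x - \<Sum> \<langle>x, u\<^sub>j\<rangle> u\<^sub>j\<parallel>\<^sup>2 \<ge> 0\<close> multiplied out.\<close>

lemma bessel:
  assumes "orthonormal k u"
  shows "(\<Sum>j=1..k. (cmod (cinner x (u j)))\<^sup>2) \<le> (norm x)\<^sup>2"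
proof -
  let ?p = "\<Sum>j=1..k. cinner x (u j) *s u j"
  have pu: "cinner ?p (u j) = cinner x (u j)" if "j \<in> {1..k}" for j
    using cinner_orthonormal_sum[OF assms that] .
  have xp: "cinner x ?p = of_real (\<Sum>j=1..k. (cmod (cinner x (u j)))\<^sup>2)"
    by (simp add: cinner_sum_right cinner_scale_right cnj_mult_cmod)
  have pp: "cinner ?p ?p = of_real (\<Sum>j=1..k. (cmod (cinner x (u j)))\<^sup>2)"
    unfolding cinner_sum_right[of ?p] cinner_scale_right
    using pu by (simp add: cnj_mult_cmod)
  have px: "cinner ?p x = of_real (\<Sum>j=1..k. (cmod (cinner x (u j)))\<^sup>2)"
    using xp cnj_cinner[of x ?p] by (metis complex_cnj_complex_of_real)
  have "0 \<le> Re (cinner (x - ?p) (x - ?p))"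
    by (simp add: Re_cinner_self)
  also have "\<dots> = (norm x)\<^sup>2 - (\<Sum>j=1..k. (cmod (cinner x (u j)))\<^sup>2)"
    unfolding cinner_diff_left cinner_diff_right xp pp px by (simp add: Re_cinner_self)
  finally show ?thesis by simp
qed

lemma cinner_le_orthonormal:
  assumes "orthonormal k u" "j \<in> {1..k}"
  shows "cmod (cinner x (u j)) \<le> norm x"
proof -
  have "(cmod (cinner x (u j)))\<^sup>2 \<le> (\<Sum>j=1..k. (cmod (cinner x (u j)))\<^sup>2)"
    by (rule member_le_sum) (use assms in auto)
  then have "(cmod (cinner x (u j)))\<^sup>2 \<le> (norm x)\<^sup>2"
    using bessel[OF assms(1), of x] by linarith
  then show ?thesis by (simp add: power2_le_iff_abs_le)
qed

text \<open>
  The next two existence statements come from square matrices that are not invertible. A nonzero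
  kernel vector is the orthogonal vector when the rows are conjugates of the given vectors, and
  the coefficient family when the columns are the given vectors.
\<close>

lemma singular_kernel:
  fixes A :: "complex^'n^'n"
  assumes "\<nexists>B. A ** B = mat 1"
  obtains x where "x \<noteq> 0" "A *v x = 0"
  using assms matrix_left_invertible_ker[of A] matrix_left_right_inverse[of A] by metis

lemma nat_index_bij:
  obtains h :: "'n::finite \<Rightarrow> nat" where "bij_betw h UNIV {1..CARD('n)}"
  using ex_bij_betw_finite_nat[of "UNIV :: 'n set"]
    bij_betw_same_card finite_same_card_bij[of "UNIV :: 'n set" "{1..CARD('n)}"] by auto

lemma orthogonal_vector_exists:
  fixes u :: "nat \<Rightarrow> complex^'n"
  assumes "k < CARD('n)"
  obtains x where "norm x = 1" "\<And>j. j \<in> {1..k} \<Longrightarrow> cinner x (u j) = 0"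
proof -
  obtain h :: "'n \<Rightarrow> nat" where h: "bij_betw h UNIV {1..CARD('n)}"
    using nat_index_bij .
  define A :: "complex^'n^'n" where "A = (\<chi> i l. if h i \<le> k then cnj (u (h i) $ l) else 0)"
  have "CARD('n) \<in> h ` UNIV"
    using h by (simp add: bij_betw_def Suc_leI)
  then obtain i where i: "h i = CARD('n)" by auto
  have "\<nexists>B. A ** B = mat 1"
  proof
    assume "\<exists>B. A ** B = mat 1"
    then obtain B where "A ** B = mat 1" ..
    then have "(A ** B) $ i $ i = 1" by (simp add: mat_def)
    moreover have "(A ** B) $ i $ i = 0"
      using i assms by (simp add: A_def matrix_matrix_mult_def)
    ultimately show False by simp
  qed
  then obtain x where x: "x \<noteq> 0" "A *v x = 0" using singular_kernel by blast
  have "cinner x (u j) = 0" if "j \<in> {1..k}" for j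
  proof -
    have "j \<in> h ` UNIV" using that h assms by (auto simp: bij_betw_def)
    then obtain i where i: "h i = j" by auto
    have "(A *v x) $ i = cinner x (u j)"
      using that i by (simp add: A_def matrix_vector_mult_def cinner_def mult.commute)
    then show ?thesis using x by simp
  qed
  then show thesis
    using x(1) by (intro that[of "(1 / norm x) *\<^sub>R x"])
      (simp, simp only: scaleR_eq_scale cinner_scale_left mult_zero_right)
qed

lemma dependency_exists:
  fixes \<phi> :: "nat \<Rightarrow> complex^'n"
  assumes "CARD('n) \<le> m" "u \<noteq> 0" "\<And>i. i \<in> {1..m} \<Longrightarrow> cinner (\<phi> i) u = 0"
  obtains w where "(\<Sum>i=1..m. (cmod (w i))\<^sup>2) = (1::real)" "(\<Sum>i=1..m. w i *s \<phi> i) = 0"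
proof -
  obtain h :: "'n \<Rightarrow> nat" where h: "bij_betw h UNIV {1..CARD('n)}"
    using nat_index_bij .
  define A :: "complex^'n^'n" where "A = (\<chi> i l. \<phi> (h l) $ i)"
  have Av: "A *v y = (\<Sum>l\<in>UNIV. y $ l *s \<phi> (h l))" for y
    by (simp add: A_def vec_eq_iff matrix_vector_mult_def mult.commute)
  have hm: "h l \<in> {1..m}" for l
    using bij_betwE[OF h] assms(1) by (meson UNIV_I atLeastAtMost_iff order_trans)
  have "\<nexists>B. A ** B = mat 1"
  proof
    assume "\<exists>B. A ** B = mat 1"
    then obtain B where "A ** B = mat 1" ..
    then have "u = A *v (B *v u)" by (simp add: matrix_vector_mul_assoc)
    then have "cinner u u = cinner (A *v (B *v u)) u" by simp
    also have "\<dots> = 0"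
      using assms(3)[OF hm] by (simp add: Av cinner_sum_left cinner_scale_left)
    finally show False using assms(2) by (simp add: cinner_self)
  qed
  then obtain x where x: "x \<noteq> 0" "A *v x = 0" using singular_kernel by blast
  define g where "g = inv_into UNIV h"
  have gh: "g (h l) = l" for l using h by (simp add: g_def bij_betw_def)
  define w where "w i = (if i \<in> {1..CARD('n)} then x $ g i / of_real (norm x) else 0)" for i
  have S: "(\<Sum>i=1..m. F (w i) i) = (\<Sum>l\<in>UNIV. F (x $ l / of_real (norm x)) (h l))"
    if "\<And>i. F 0 i = 0" for F :: "complex \<Rightarrow> nat \<Rightarrow> 'b::comm_monoid_add"
  proof -
    have "(\<Sum>i=1..m. F (w i) i) = (\<Sum>i=1..CARD('n). F (w i) i)"
      by (rule sum.mono_neutral_right) (use assms(1) that in \<open>auto simp: w_def\<close>)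
    also have "\<dots> = (\<Sum>l\<in>UNIV. F (w (h l)) (h l))"
      by (rule sum.reindex_bij_betw[OF h, symmetric])
    also have "\<dots> = (\<Sum>l\<in>UNIV. F (x $ l / of_real (norm x)) (h l))"
      using h by (intro sum.cong) (auto simp: w_def gh bij_betw_def)
    finally show ?thesis .
  qed
  have "(\<Sum>i=1..m. (cmod (w i))\<^sup>2) = (\<Sum>l\<in>UNIV. (cmod (x $ l))\<^sup>2) / (norm x)\<^sup>2"
    by (subst S[of "\<lambda>z _. (cmod z)\<^sup>2"])
      (simp_all add: norm_divide power_divide sum_divide_distrib)
  also have "(\<Sum>l\<in>UNIV. (cmod (x $ l))\<^sup>2) = (norm x)\<^sup>2"
    by (simp add: norm_vec_def L2_set_def sum_nonneg)
  also have "\<dots> / (norm x)\<^sup>2 = 1" using x(1) by simp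
  finally have 1: "(\<Sum>i=1..m. (cmod (w i))\<^sup>2) = 1" .
  have "(\<Sum>i=1..m. w i *s \<phi> i) = of_real (1 / norm x) *s (A *v x)"
    by (subst S[of "\<lambda>z i. z *s \<phi> i"]) (simp_all add: Av vec.scale_sum_right)
  then show thesis using that 1 x(2) by simp
qed

text \<open>
  A nonzero remainder \<open>y\<close> would be orthogonal to all \<open>u\<^sub>j\<close>, so \<open>d\<close> vectors in a hyperplane
  would be independent.
\<close>

lemma orthonormal_expansion:
  fixes u :: "nat \<Rightarrow> complex^'n"
  assumes "orthonormal CARD('n) u"
  shows "x = (\<Sum>j=1..CARD('n). cinner x (u j) *s u j)"
proof (rule ccontr)
  let ?p = "\<Sum>j=1..CARD('n). cinner x (u j) *s u j"
  assume ne: "x \<noteq> ?p"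
  define y where "y = x - ?p"
  have y: "y \<noteq> 0" "cinner y (u j) = 0" if "j \<in> {1..CARD('n)}" for j
    using ne cinner_orthonormal_sum[OF assms that] by (auto simp: y_def cinner_diff_left)
  then have y0: "y \<noteq> 0" using ne y_def by simp
  have uy: "cinner (u j) y = 0" if "j \<in> {1..CARD('n)}" for j
    using y(2)[OF that] by (metis cnj_cinner complex_cnj_zero)
  obtain w where w: "(\<Sum>i=1..CARD('n). (cmod (w i))\<^sup>2) = (1::real)"
      "(\<Sum>i=1..CARD('n). w i *s u i) = 0"
    using dependency_exists[OF order_refl y0, of u] uy by metis
  have "w j = 0" if "j \<in> {1..CARD('n)}" for j
    using cinner_orthonormal_sum[OF assms that, of w] w(2) by simp
  then show False using w(1) by simp
qed

lemma orthonormal_basis_iff: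
  fixes u :: "nat \<Rightarrow> complex^'n"
  shows "orthonormal_basis u \<longleftrightarrow> orthonormal CARD('n) u"
proof
  assume u: "orthonormal CARD('n) u"
  have "x \<in> vec.span (u ` {1..CARD('n)})" for x
    by (subst orthonormal_expansion[OF u, of x])
      (intro vec.span_sum vec.span_scale vec.span_base imageI)
  then show "orthonormal_basis u"
    using u by (auto simp: orthonormal_basis_def orthonormal_def)
qed (simp add: orthonormal_basis_def orthonormal_def)

lemma parseval:
  fixes u :: "nat \<Rightarrow> complex^'n"
  assumes "orthonormal CARD('n) u"
  shows "(norm x)\<^sup>2 = (\<Sum>j=1..CARD('n). (cmod (cinner x (u j)))\<^sup>2)"
proof -
  have "cinner x x = cinner x (\<Sum>j=1..CARD('n). cinner x (u j) *s u j)"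
    using orthonormal_expansion[OF assms, of x] by simp
  also have "\<dots> = of_real (\<Sum>j=1..CARD('n). (cmod (cinner x (u j)))\<^sup>2)"
    by (simp add: cinner_sum_right cinner_scale_right cnj_mult_cmod)
  finally show ?thesis unfolding cinner_self of_real_eq_iff .
qed

section \<open>Eigensystems of frame operators\<close>

definition eigensystem :: "complex^'n^'n \<Rightarrow> (nat \<Rightarrow> complex^'n) \<Rightarrow> (nat \<Rightarrow> real) \<Rightarrow> bool" where
  "eigensystem S u l \<longleftrightarrow> orthonormal CARD('n) u \<and>
     (\<forall>j\<in>{1..CARD('n)}. S *v u j = complex_of_real (l j) *s u j)"

lemma eigensystem_orthonormal:
  fixes S :: "complex^'n^'n"
  shows "eigensystem S u l \<Longrightarrow> orthonormal CARD('n) u"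
  by (simp add: eigensystem_def)

lemma mult_vec_sum: "(A :: complex^'n^'k) *v (\<Sum>i\<in>I. g i) = (\<Sum>i\<in>I. A *v g i)"
  by (induction I rule: infinite_finite_induct) (simp_all add: matrix_vector_right_distrib)

lemma eigensystem_mult:
  fixes S :: "complex^'n^'n"
  assumes "eigensystem S u l"
  shows "S *v x = (\<Sum>j=1..CARD('n). (of_real (l j) * cinner x (u j)) *s u j)"
proof -
  have "S *v x = S *v (\<Sum>j=1..CARD('n). cinner x (u j) *s u j)"
    using orthonormal_expansion[OF eigensystem_orthonormal[OF assms], of x] by simp
  also have "\<dots> = (\<Sum>j=1..CARD('n). cinner x (u j) *s (S *v u j))"
    by (simp add: mult_vec_sum vector_scalar_commute)
  also have "\<dots> = (\<Sum>j=1..CARD('n). (of_real (l j) * cinner x (u j)) *s u j)"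
    using assms by (intro sum.cong) (simp_all add: eigensystem_def mult.commute)
  finally show ?thesis .
qed

lemma eigensystem_quad:
  fixes S :: "complex^'n^'n"
  assumes "eigensystem S u l"
  shows "cinner (S *v x) x = of_real (\<Sum>j=1..CARD('n). l j * (cmod (cinner x (u j)))\<^sup>2)"
  unfolding eigensystem_mult[OF assms] cinner_sum_left cinner_scale_left
  using cinner_mult_cnj[of x] by (simp add: mult.assoc)

lemma tr_fun_eigensystem:
  fixes S :: "complex^'n^'n"
  assumes "eigensystem S u l"
  shows "tr_fun f S = (\<Sum>j=1..CARD('n). f (l j))"
proof -
  obtain h :: "'n \<Rightarrow> nat" where h: "bij_betw h UNIV {1..CARD('n)}"
    using nat_index_bij .
  have hin: "h i \<in> {1..CARD('n)}" for i using bij_betwE[OF h] by simp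
  have hinj: "h i = h j \<longleftrightarrow> i = j" for i j using h by (auto simp: bij_betw_def inj_def)
  define U :: "complex^'n^'n" where "U = (\<chi> i j. u (h j) $ i)"
  have "(cadjoint U ** U) $ i $ j = cinner (u (h j)) (u (h i))" for i j
    by (simp add: matrix_matrix_mult_def cadjoint_def U_def cinner_def mult.commute)
  then have UU: "cadjoint U ** U = mat 1"
    using orthonormalD[OF eigensystem_orthonormal[OF assms] hin hin]
    by (simp add: vec_eq_iff mat_def hinj eq_commute)
  then have U: "unitary_matrix U"
    by (simp add: unitary_matrix_def matrix_left_right_inverse)
  have "(S ** U) $ i $ j = (U ** real_diag (l \<circ> h)) $ i $ j" for i j
  proof -
    have "(S ** U) $ i $ j = (S *v u (h j)) $ i"
      by (simp add: matrix_matrix_mult_def matrix_vector_mult_def U_def)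
    also have "\<dots> = (U ** real_diag (l \<circ> h)) $ i $ j"
      using assms hin[of j]
      by (simp add: eigensystem_def matrix_matrix_mult_def real_diag_def U_def if_distrib mult.commute
          cong: if_cong)
    finally show ?thesis .
  qed
  then have "S ** U = U ** real_diag (l \<circ> h)" by (simp add: vec_eq_iff)
  then have "S ** (U ** cadjoint U) = U ** real_diag (l \<circ> h) ** cadjoint U"
    by (simp add: matrix_mul_assoc)
  then have "S = U ** real_diag (l \<circ> h) ** cadjoint U"
    using U by (simp add: unitary_matrix_def)
  from tr_fun_eq_sum(2)[OF U this] have "tr_fun f S = (\<Sum>i\<in>UNIV. f (l (h i)))" by simp
  also have "\<dots> = (\<Sum>j=1..CARD('n). f (l j))"
    by (rule sum.reindex_bij_betw[OF h])
  finally show ?thesis .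
qed

lemma frame_quad:
  "cinner (frame_operator m \<phi> *v x) x = of_real (\<Sum>i=1..m. (cmod (cinner x (\<phi> i)))\<^sup>2)"
  unfolding frame_operator_mult cinner_sum_left cinner_scale_left
  by (simp only: cinner_mult_cnj of_real_sum)

lemma frame_operator_selfadjoint:
  "cinner (frame_operator m \<phi> *v x) y = cinner x (frame_operator m \<phi> *v y)"
  by (simp add: frame_operator_mult cinner_sum_left cinner_sum_right cinner_scale_left
      cinner_scale_right cnj_cinner mult.commute)

lemma eigenvalue_eq:
  fixes \<phi> :: "nat \<Rightarrow> complex^'n"
  assumes "eigensystem (frame_operator m \<phi>) u l" "j \<in> {1..CARD('n)}"
  shows "l j = (\<Sum>i=1..m. (cmod (cinner (u j) (\<phi> i)))\<^sup>2)"
proof -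
  have "cinner (frame_operator m \<phi> *v u j) (u j) = of_real (l j)"
    using assms orthonormalD[OF eigensystem_orthonormal[OF assms(1)] assms(2) assms(2)]
    by (simp add: eigensystem_def cinner_scale_left)
  then show ?thesis unfolding frame_quad of_real_eq_iff by simp
qed

lemma eigenvalue_nonneg:
  fixes \<phi> :: "nat \<Rightarrow> complex^'n"
  assumes "eigensystem (frame_operator m \<phi>) u l" "j \<in> {1..CARD('n)}"
  shows "0 \<le> l j"
  unfolding eigenvalue_eq[OF assms] by (simp add: sum_nonneg)

lemma eigenvalue_sum:
  fixes \<phi> :: "nat \<Rightarrow> complex^'n"
  assumes "eigensystem (frame_operator m \<phi>) u l"
  shows "(\<Sum>j=1..CARD('n). l j) = (\<Sum>i=1..m. (norm (\<phi> i))\<^sup>2)"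
proof -
  have "(\<Sum>j=1..CARD('n). l j) = (\<Sum>j=1..CARD('n). \<Sum>i=1..m. (cmod (cinner (\<phi> i) (u j)))\<^sup>2)"
    using eigenvalue_eq[OF assms] by (intro sum.cong) (simp_all add: cmod_cinner_commute)
  also have "\<dots> = (\<Sum>i=1..m. (norm (\<phi> i))\<^sup>2)"
    by (subst sum.swap) (simp add: parseval[OF eigensystem_orthonormal[OF assms]])
  finally show ?thesis .
qed

text \<open>
  The spectral theorem, by maximizing the quadratic form on the unit vectors orthogonal to the
  eigenvectors found so far. Each maximizer is an eigenvector because the form
  \<open>\<mu> \<parallel>x\<parallel>\<^sup>2 - \<langle>S x, x\<rangle>\<close> is nonnegative there and vanishes at it; this order of construction
  also sorts the eigenvalues.
\<close>

lemma sorted_eigensystem_exists: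
  fixes S :: "complex^'n^'n"
  assumes sa: "\<And>x y. cinner (S *v x) y = cinner x (S *v y)"
  obtains u l where "eigensystem S u l" "antimono_on {1..CARD('n)} l"
proof -
  have "\<exists>u l. orthonormal k u \<and> (\<forall>j\<in>{1..k}. S *v u j = complex_of_real (l j) *s u j) \<and>
      antimono_on {1..k} l \<and>
      (k \<noteq> 0 \<longrightarrow> (\<forall>x. norm x = 1 \<longrightarrow> (\<forall>j\<in>{1..k}. cinner x (u j) = 0) \<longrightarrow> Re (cinner (S *v x) x) \<le> l k))"
    if "k \<le> CARD('n)" for k
    using that
  proof (induction k)
    case 0
    then show ?case by (simp add: orthonormal_def monotone_on_def)
  next
    case (Suc k)
    then obtain u l where u: "orthonormal k u"
      and eig: "\<forall>j\<in>{1..k}. S *v u j = complex_of_real (l j) *s u j"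
      and l: "antimono_on {1..k} l"
      and top: "k \<noteq> 0 \<longrightarrow> (\<forall>x. norm x = 1 \<longrightarrow> (\<forall>j\<in>{1..k}. cinner x (u j) = 0) \<longrightarrow>
        Re (cinner (S *v x) x) \<le> l k)"
      using Suc.IH[OF Suc_leD[OF Suc.prems]] by (elim exE conjE) (rule that)
    define V where "V = {x. \<forall>j\<in>{1..k}. cinner x (u j) = 0}"
    define K where "K = {x \<in> V. norm x = 1}"
    have "K = sphere 0 1 \<inter> (\<Inter>j\<in>{1..k}. {x. cinner x (u j) = 0})"
      by (auto simp: K_def V_def)
    moreover have "closed {x. cinner x (u j) = 0}" for j
      unfolding cinner_def by (intro closed_Collect_eq continuous_intros)
    ultimately have "compact K"
      by (simp add: compact_Int_closed closed_INT)
    moreover have "K \<noteq> {}"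
    proof -
      obtain x where "norm x = 1" "\<And>j. j \<in> {1..k} \<Longrightarrow> cinner x (u j) = 0"
        using orthogonal_vector_exists[of k u] Suc.prems Suc_le_eq by metis
      then have "x \<in> K" by (simp add: K_def V_def)
      then show ?thesis by blast
    qed
    moreover have "continuous_on K (\<lambda>x. Re (cinner (S *v x) x))"
      unfolding cinner_def matrix_vector_mult_def by (auto intro!: continuous_intros)
    ultimately obtain v where v: "v \<in> K"
      and vmax: "\<And>x. x \<in> K \<Longrightarrow> Re (cinner (S *v x) x) \<le> Re (cinner (S *v v) v)"
      using continuous_attains_sup[of K] by blast
    define \<mu> where "\<mu> = Re (cinner (S *v v) v)"
    define Q where "Q x = \<mu> * (norm x)\<^sup>2 - Re (cinner (S *v x) x)" for x
    have Q: "0 \<le> Q x" if "x \<in> V" for x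
    proof (cases "x = 0")
      case False
      have "(1 / norm x) *\<^sub>R x \<in> K"
        using that False
        by (simp add: K_def V_def) (simp only: scaleR_eq_scale cinner_scale_left, simp)
      from vmax[OF this] have "Re (cinner (S *v ((1 / norm x) *\<^sub>R x)) ((1 / norm x) *\<^sub>R x)) \<le> \<mu>"
        by (simp add: \<mu>_def)
      moreover have "cinner (S *v ((1 / norm x) *\<^sub>R x)) ((1 / norm x) *\<^sub>R x) =
          of_real (1 / (norm x)\<^sup>2) * cinner (S *v x) x"
        unfolding scaleR_eq_scale vector_scalar_commute cinner_scale_left cinner_scale_right
        by (simp add: power2_eq_square)
      ultimately have "Re (cinner (S *v x) x) / (norm x)\<^sup>2 \<le> \<mu>" by simp
      then show ?thesis using False by (simp add: Q_def field_simps)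
    qed (simp add: Q_def)
    define w where "w = complex_of_real \<mu> *s v - S *v v"
    have vV: "v \<in> V" "norm v = 1" using v by (auto simp: K_def)
    have wV: "w \<in> V"
      using vV(1) eig by (simp add: V_def w_def cinner_diff_left cinner_scale_left sa cinner_scale_right)
    have quad: "0 \<le> t\<^sup>2 * Q w - 2 * t * (norm w)\<^sup>2" for t
    proof -
      let ?x = "v - complex_of_real t *s w"
      have "?x \<in> V" using vV wV by (simp add: V_def cinner_simps)
      then have "0 \<le> Q ?x" by (rule Q)
      have Re_sym: "Re (cinner v w) = Re (cinner w v)"
        "Re (cinner (S *v v) w) = Re (cinner w (S *v v))"
        by (metis cnj_cinner cnj.sel(1))+
      have "Q ?x = \<mu> * Re (cinner ?x ?x) - Re (cinner (S *v ?x) ?x)"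
        by (simp add: Q_def Re_cinner_self)
      also have "\<dots> = Q v + t\<^sup>2 * Q w - 2 * t * (\<mu> * Re (cinner w v) - Re (cinner w (S *v v)))"
        unfolding Q_def Re_cinner_self[symmetric] matrix_vector_mult_diff_distrib
          vector_scalar_commute cinner_simps
        using Re_sym
        by (simp add: sa[of w v] power2_eq_square algebra_simps)
      also have "\<mu> * Re (cinner w v) - Re (cinner w (S *v v)) = Re (cinner w w)"
        by (subst (4) w_def) (simp add: cinner_diff_right cinner_scale_right)
      also have "Q v = 0" by (simp add: Q_def \<mu>_def vV)
      finally show ?thesis using \<open>0 \<le> Q ?x\<close> by (simp add: Re_cinner_self)
    qed
    have "(norm w)\<^sup>2 = 0"
    proof -
      \<comment> \<open>For this value of \<open>t\<close> the quadratic is negative unless \<open>w = 0\<close>.\<close>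
      define s where "s = (norm w)\<^sup>2 / (Q w + 1)"
      have q: "0 \<le> Q w" using Q[OF wV] .
      then have N: "(norm w)\<^sup>2 = s * (Q w + 1)" by (simp add: s_def)
      have "0 \<le> s\<^sup>2 * Q w - 2 * s * (s * (Q w + 1))" using quad[of s] by (simp only: N)
      also have "\<dots> = - (s\<^sup>2 * (Q w + 2))"
        by (simp add: algebra_simps power2_eq_square)
      finally have "s = 0" using q by (simp add: mult_le_0_iff)
      then show ?thesis using N by simp
    qed
    then have Sv: "S *v v = complex_of_real \<mu> *s v" by (simp add: w_def)
    have mu: "\<mu> \<le> l k" if "k \<noteq> 0"
      using top that vV by (simp add: V_def \<mu>_def)
    let ?u = "u(Suc k := v)" and ?l = "l(Suc k := \<mu>)"
    have mu_le: "\<mu> \<le> l j" if "j \<in> {1..k}" for j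
    proof -
      have "l k \<le> l j" using l that by (auto simp: monotone_on_def)
      then show ?thesis using mu that by auto
    qed
    have "orthonormal (Suc k) ?u"
      using orthonormal_snoc[OF u vV(2)] vV(1) by (auto simp: V_def)
    moreover have "\<forall>j\<in>{1..Suc k}. S *v ?u j = complex_of_real (?l j) *s ?u j"
      using eig Sv by (auto simp: le_Suc_eq)
    moreover have "antimono_on {1..Suc k} ?l"
    proof (rule monotone_onI)
      fix i j assume "i \<in> {1..Suc k}" "j \<in> {1..Suc k}" "i \<le> j"
      then show "?l i \<ge> ?l j"
        using l mu_le[of i] by (cases "j = Suc k"; cases "i = Suc k") (auto simp: monotone_on_def)
    qed
    moreover have "Re (cinner (S *v x) x) \<le> ?l (Suc k)"
      if "norm x = 1" "\<forall>j\<in>{1..Suc k}. cinner x (?u j) = 0" for x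
    proof -
      have "cinner x (u j) = 0" if "j \<in> {1..k}" for j
        using bspec[OF \<open>\<forall>j\<in>{1..Suc k}. cinner x (?u j) = 0\<close>, of j] that by simp
      then have "x \<in> K" using that(1) by (simp add: K_def V_def)
      then show ?thesis using vmax[of x] by (simp add: \<mu>_def)
    qed
    ultimately show ?case by (intro exI[of _ ?u] exI[of _ ?l] conjI impI allI)
  qed
  from this[of "CARD('n)"] show thesis using that by (auto simp: eigensystem_def)
qed

section \<open>Partial sums of eigenvalues\<close>

text \<open>
  Among weights in \<open>[0, 1]\<close> of total at most \<open>k\<close>, the best choice is 1 on the first \<open>k\<close>
  places. The proof compares with this choice \<open>v\<close>: both factors of
  \<open>(l j - l k) * (v j - w j)\<close> change sign at \<open>k\<close>.
\<close>

lemma weighted_sum_le: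
  fixes l w :: "nat \<Rightarrow> real"
  assumes l: "antimono_on {1..d} l" "\<And>j. j \<in> {1..d} \<Longrightarrow> 0 \<le> l j"
    and w: "\<And>j. j \<in> {1..d} \<Longrightarrow> 0 \<le> w j" "\<And>j. j \<in> {1..d} \<Longrightarrow> w j \<le> 1"
    and sum: "(\<Sum>j=1..d. w j) \<le> real k" and k: "k \<in> {1..d}"
  shows "(\<Sum>j=1..d. l j * w j) \<le> (\<Sum>j=1..k. l j)"
proof -
  define v where "v j = (if j \<le> k then 1 else 0 :: real)" for j
  have "(\<Sum>j=1..d. v j) = (\<Sum>j=1..k. 1)"
    unfolding v_def by (rule sum.mono_neutral_cong_right) (use k in auto)
  then have sv: "(\<Sum>j=1..d. v j) = real k" by simp
  have "(\<Sum>j=1..d. l j * v j) = (\<Sum>j=1..k. l j)"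
    unfolding v_def by (rule sum.mono_neutral_cong_right) (use k in auto)
  moreover have "0 \<le> (\<Sum>j=1..d. (l j - l k) * (v j - w j))"
  proof (rule sum_nonneg)
    fix j assume j: "j \<in> {1..d}"
    show "0 \<le> (l j - l k) * (v j - w j)"
    proof (cases "j \<le> k")
      case True
      then have "l k \<le> l j" using l(1) j k by (auto simp: monotone_on_def)
      then show ?thesis using True w(2)[OF j] by (simp add: v_def)
    next
      case False
      then have "l j \<le> l k" using l(1) j k by (auto simp: monotone_on_def)
      then show ?thesis using False w(1)[OF j] by (simp add: v_def mult_nonpos_nonneg)
    qed
  qed
  moreover have "(\<Sum>j=1..d. (l j - l k) * (v j - w j)) =
      (\<Sum>j=1..d. l j * v j) - (\<Sum>j=1..d. l j * w j) - l k * ((\<Sum>j=1..d. v j) - (\<Sum>j=1..d. w j))"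
    by (simp add: algebra_simps sum.distrib sum_subtractf sum_distrib_left)
  moreover have "0 \<le> l k * ((\<Sum>j=1..d. v j) - (\<Sum>j=1..d. w j))"
    using l(2)[OF k] sum sv by simp
  ultimately show ?thesis by linarith
qed

text \<open>
  In the eigenbasis, the weight of \<open>l j\<close> is the sum of \<open>|\<langle>x\<^sub>i, u\<^sub>j\<rangle>|\<^sup>2\<close> over \<open>i\<close>, which Bessel's
  inequality bounds by 1.
\<close>

lemma ky_fan:
  fixes S :: "complex^'n^'n"
  assumes S: "eigensystem S u l" "antimono_on {1..CARD('n)} l" "\<And>j. j \<in> {1..CARD('n)} \<Longrightarrow> 0 \<le> l j"
    and x: "orthonormal k x" "k \<in> {1..CARD('n)}"
  shows "(\<Sum>i=1..k. Re (cinner (S *v x i) (x i))) \<le> (\<Sum>j=1..k. l j)"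
proof -
  note u = eigensystem_orthonormal[OF S(1)]
  define w where "w j = (\<Sum>i=1..k. (cmod (cinner (x i) (u j)))\<^sup>2)" for j
  have "w j \<le> 1" if "j \<in> {1..CARD('n)}" for j
    using bessel[OF x(1), of "u j"] orthonormal_norm[OF u that]
    by (simp add: w_def cmod_cinner_commute)
  moreover have "(\<Sum>j=1..CARD('n). w j) = real k"
  proof -
    have "(\<Sum>j=1..CARD('n). w j) = (\<Sum>i=1..k. (norm (x i))\<^sup>2)"
      unfolding w_def by (subst sum.swap) (simp add: parseval[OF u])
    also have "\<dots> = real k" using orthonormal_norm[OF x(1)] by simp
    finally show ?thesis .
  qed
  moreover have "(\<Sum>i=1..k. Re (cinner (S *v x i) (x i))) = (\<Sum>j=1..CARD('n). l j * w j)"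
    unfolding w_def sum_distrib_left eigensystem_quad[OF S(1)] Re_complex_of_real
    by (rule sum.swap)
  ultimately show ?thesis
    using weighted_sum_le[OF S(2,3), of w k] x(2) by (simp add: w_def sum_nonneg)
qed

text \<open>
  The sum is \<open>\<langle>y, \<phi>\<^sub>i\<rangle>\<close> with \<open>y = S\<^sup>+ \<phi>\<^sub>i\<close>, and it is also \<open>\<langle>S y, y\<rangle> \<ge> |\<langle>y, \<phi>\<^sub>i\<rangle>|\<^sup>2\<close>; a number
  that dominates its own square is at most 1. Terms with \<open>l j = 0\<close> vanish by the convention
  on division.
\<close>

lemma frame_vector_weights_le_1:
  fixes \<phi> :: "nat \<Rightarrow> complex^'n"
  assumes S: "eigensystem (frame_operator m \<phi>) u l" and i: "i \<in> {1..m}"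
  shows "(\<Sum>j=1..CARD('n). (cmod (cinner (\<phi> i) (u j)))\<^sup>2 / l j) \<le> 1"
proof -
  note u = eigensystem_orthonormal[OF S]
  define s where "s = (\<Sum>j=1..CARD('n). (cmod (cinner (\<phi> i) (u j)))\<^sup>2 / l j)"
  define y where "y = (\<Sum>j=1..CARD('n). (cinner (\<phi> i) (u j) / of_real (l j)) *s u j)"
  have yu: "cinner y (u j) = cinner (\<phi> i) (u j) / of_real (l j)" if "j \<in> {1..CARD('n)}" for j
    unfolding y_def using cinner_orthonormal_sum[OF u that] .
  have "cinner y (\<phi> i) = of_real s"
    unfolding y_def s_def cinner_sum_left cinner_scale_left of_real_sum
    by (intro sum.cong refl) (use cinner_mult_cnj[of "\<phi> i"] in simp)
  moreover have "Re (cinner (frame_operator m \<phi> *v y) y) = s"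
    unfolding eigensystem_quad[OF S] s_def Re_complex_of_real
    by (intro sum.cong refl) (simp add: yu norm_divide power_divide power2_eq_square)
  moreover have "(cmod (cinner y (\<phi> i)))\<^sup>2 \<le> (\<Sum>i=1..m. (cmod (cinner y (\<phi> i)))\<^sup>2)"
    by (rule member_le_sum) (use i in auto)
  ultimately have "s\<^sup>2 \<le> s" by (simp add: frame_quad)
  have "s \<le> 1"
  proof (rule ccontr)
    assume "\<not> s \<le> 1"
    then have "s * 1 < s * s" by (intro mult_strict_left_mono) auto
    then show False using \<open>s\<^sup>2 \<le> s\<close> by (simp add: power2_eq_square)
  qed
  then show ?thesis by (simp add: s_def)
qed

text \<open>
  The easy half of the Schur-Horn theorem: \<open>\<parallel>\<phi>\<^sub>i\<parallel>\<^sup>2\<close> is the average of the eigenvalues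
  \<open>l j\<close> with weights \<open>|\<langle>\<phi>\<^sub>i, u\<^sub>j\<rangle>|\<^sup>2 / l j\<close>, whose sums over \<open>i\<close> and over \<open>j\<close> are at most 1.
\<close>

lemma sum_norms_le_sum_eigenvalues:
  fixes \<phi> :: "nat \<Rightarrow> complex^'n"
  assumes S: "eigensystem (frame_operator m \<phi>) u l" and l: "antimono_on {1..CARD('n)} l"
    and k: "k \<in> {1..CARD('n)}" "k \<le> m"
  shows "(\<Sum>i=1..k. (norm (\<phi> i))\<^sup>2) \<le> (\<Sum>j=1..k. l j)"
proof -
  note u = eigensystem_orthonormal[OF S] and l0 = eigenvalue_nonneg[OF S]
  define p where "p i j = (cmod (cinner (\<phi> i) (u j)))\<^sup>2 / l j" for i j
  have lsum: "l j = (\<Sum>i=1..m. (cmod (cinner (\<phi> i) (u j)))\<^sup>2)" if "j \<in> {1..CARD('n)}" for j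
    using eigenvalue_eq[OF S that] by (simp add: cmod_cinner_commute)
  have p0: "0 \<le> p i j" if "j \<in> {1..CARD('n)}" for i j
    using l0[OF that] by (simp add: p_def)
  have lp: "l j * p i j = (cmod (cinner (\<phi> i) (u j)))\<^sup>2" if "j \<in> {1..CARD('n)}" "i \<in> {1..m}" for i j
  proof (cases "l j = 0")
    case True
    then have "(cmod (cinner (\<phi> i) (u j)))\<^sup>2 = 0"
      using lsum[OF that(1)] that(2) by (simp add: sum_nonneg_eq_0_iff)
    then show ?thesis using True by (simp add: p_def)
  qed (simp add: p_def)
  define w where "w j = (\<Sum>i=1..k. p i j)" for j
  have "w j \<le> 1" if "j \<in> {1..CARD('n)}" for j
  proof -
    have "w j \<le> (\<Sum>i=1..m. p i j)"
      unfolding w_def by (rule sum_mono2) (use k p0[OF that] in auto)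
    also have "\<dots> = l j / l j"
      by (simp add: p_def lsum[OF that] flip: sum_divide_distrib)
    also have "\<dots> \<le> 1" by simp
    finally show ?thesis .
  qed
  moreover have "0 \<le> w j" if "j \<in> {1..CARD('n)}" for j
    unfolding w_def by (intro sum_nonneg p0 that)
  moreover have "(\<Sum>j=1..CARD('n). w j) \<le> real k"
  proof -
    have "(\<Sum>j=1..CARD('n). w j) = (\<Sum>i=1..k. \<Sum>j=1..CARD('n). p i j)"
      unfolding w_def by (rule sum.swap)
    also have "\<dots> \<le> (\<Sum>i=1..k. 1)"
      by (rule sum_mono) (use frame_vector_weights_le_1[OF S] k in \<open>auto simp: p_def\<close>)
    finally show ?thesis by simp
  qed
  moreover have "(\<Sum>i=1..k. (norm (\<phi> i))\<^sup>2) = (\<Sum>j=1..CARD('n). l j * w j)"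
  proof -
    have "(\<Sum>i=1..k. (norm (\<phi> i))\<^sup>2) = (\<Sum>i=1..k. \<Sum>j=1..CARD('n). l j * p i j)"
      using k by (intro sum.cong refl) (simp add: parseval[OF u] lp)
    also have "\<dots> = (\<Sum>j=1..CARD('n). l j * w j)"
      unfolding w_def sum_distrib_left by (rule sum.swap)
    finally show ?thesis .
  qed
  ultimately show ?thesis using weighted_sum_le[OF l l0, of w k] k by simp
qed

section \<open>Frames with prescribed norms and frame operator\<close>

lemma sum_remove2:
  fixes g :: "nat \<Rightarrow> 'b::ab_group_add"
  assumes "finite A" "j \<in> A" "k \<in> A" "j \<noteq> k"
  shows "(\<Sum>i\<in>A. g i) = g j + g k + (\<Sum>i\<in>A - {j} - {k}. g i)"
  using assms by (simp add: sum.remove[of A j] sum.remove[of "A - {j}" k] add.assoc)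

lemma frame_operator_rotate:
  fixes \<phi> :: "nat \<Rightarrow> complex^'n" and p q :: real
  assumes "j \<in> {1..m}" "k \<in> {1..m}" "j \<noteq> k" "p\<^sup>2 + q\<^sup>2 = 1"
  shows "frame_operator m (\<phi>(j := p *\<^sub>R \<phi> j + q *\<^sub>R \<phi> k, k := p *\<^sub>R \<phi> k - q *\<^sub>R \<phi> j)) =
    frame_operator m \<phi>"
proof -
  let ?\<psi> = "\<phi>(j := p *\<^sub>R \<phi> j + q *\<^sub>R \<phi> k, k := p *\<^sub>R \<phi> k - q *\<^sub>R \<phi> j)"
  have "frame_operator m ?\<psi> *v x = frame_operator m \<phi> *v x" for x
  proof -
    define P Q where "P = complex_of_real p" and "Q = complex_of_real q"
    have PQ: "P * P + Q * Q = 1"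
      using assms(4) unfolding P_def Q_def power2_eq_square
      by (metis of_real_1 of_real_add of_real_mult)
    define b c where "b = cinner x (\<phi> j)" and "c = cinner x (\<phi> k)"
    have two: "cinner x (?\<psi> j) *s ?\<psi> j + cinner x (?\<psi> k) *s ?\<psi> k = b *s \<phi> j + c *s \<phi> k"
    proof -
      have "cinner x (?\<psi> j) = P * b + Q * c" "cinner x (?\<psi> k) = P * c - Q * b"
        using assms(3) by (simp_all add: scaleR_eq_scale cinner_simps P_def Q_def b_def c_def)
      then have "cinner x (?\<psi> j) *s ?\<psi> j + cinner x (?\<psi> k) *s ?\<psi> k =
          (P * b + Q * c) *s (P *s \<phi> j + Q *s \<phi> k) + (P * c - Q * b) *s (P *s \<phi> k - Q *s \<phi> j)"
        using assms(3) by (simp add: scaleR_eq_scale P_def Q_def)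
      also have "\<dots> = ((P * P + Q * Q) * b) *s \<phi> j + ((P * P + Q * Q) * c) *s \<phi> k"
        by (simp add: vec_eq_iff algebra_simps)
      finally show ?thesis by (simp add: PQ)
    qed
    have rest: "(\<Sum>i\<in>{1..m} - {j} - {k}. cinner x (?\<psi> i) *s ?\<psi> i) =
        (\<Sum>i\<in>{1..m} - {j} - {k}. cinner x (\<phi> i) *s \<phi> i)"
      by (intro sum.cong) auto
    show ?thesis
      unfolding frame_operator_mult
        sum_remove2[OF finite_atLeastAtMost assms(1-3), of "\<lambda>i. cinner x (?\<psi> i) *s ?\<psi> i"]
        sum_remove2[OF finite_atLeastAtMost assms(1-3), of "\<lambda>i. cinner x (\<phi> i) *s \<phi> i"]
        two rest b_def c_def ..
  qed
  then show ?thesis by (simp add: matrix_eq)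
qed

text \<open>
  Turning a pair of frame vectors through a quarter turn exchanges their norms, so that every
  value in between is attained on the way; the frame operator does not notice.
\<close>

lemma transfer_norm:
  fixes \<phi> :: "nat \<Rightarrow> complex^'n"
  assumes jk: "j \<in> {1..m}" "k \<in> {1..m}" "j \<noteq> k"
    and v: "(norm (\<phi> k))\<^sup>2 \<le> v" "v \<le> (norm (\<phi> j))\<^sup>2"
  obtains \<psi> where "frame_operator m \<psi> = frame_operator m \<phi>"
    "(norm (\<psi> j))\<^sup>2 = v" "(norm (\<psi> k))\<^sup>2 = (norm (\<phi> j))\<^sup>2 + (norm (\<phi> k))\<^sup>2 - v"
    "\<And>i. i \<noteq> j \<Longrightarrow> i \<noteq> k \<Longrightarrow> \<psi> i = \<phi> i"
proof -
  define g where "g t = (norm (cos t *\<^sub>R \<phi> j + sin t *\<^sub>R \<phi> k))\<^sup>2" for t :: real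
  have "\<exists>t\<ge>0. t \<le> pi / 2 \<and> g t = v"
    by (rule IVT2') (use v in \<open>auto simp: g_def intro!: continuous_intros\<close>)
  then obtain t where t: "g t = v" by auto
  define p q where "p = cos t" and "q = sin t"
  have pq: "p\<^sup>2 + q\<^sup>2 = 1" by (simp add: p_def q_def)
  have "(norm (p *\<^sub>R \<phi> j + q *\<^sub>R \<phi> k))\<^sup>2 + (norm (p *\<^sub>R \<phi> k - q *\<^sub>R \<phi> j))\<^sup>2 =
      (p\<^sup>2 + q\<^sup>2) * ((norm (\<phi> j))\<^sup>2 + (norm (\<phi> k))\<^sup>2)"
    unfolding power2_norm_eq_inner
    by (simp add: inner_simps inner_commute[of "\<phi> k" "\<phi> j"] power2_eq_square algebra_simps)
  moreover have "(norm (p *\<^sub>R \<phi> j + q *\<^sub>R \<phi> k))\<^sup>2 = v"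
    using t by (simp add: g_def p_def q_def)
  ultimately show thesis
    using frame_operator_rotate[OF jk pq, of \<phi>] jk(3) pq
    by (intro that[of "\<phi>(j := p *\<^sub>R \<phi> j + q *\<^sub>R \<phi> k, k := p *\<^sub>R \<phi> k - q *\<^sub>R \<phi> j)"]) simp_all
qed

text \<open>
  The hard half of the Schur-Horn theorem. Let \<open>k\<close> be the first index with too little norm; the
  partial sums provide some \<open>j < k\<close> with too much. Norm is moved from \<open>j\<close> to \<open>k\<close> until one of
  the two has the norm prescribed for it. As still no index before \<open>k\<close> has too little, the
  partial sums stay large enough.
\<close>

lemma prescribe_norms:
  fixes \<phi> :: "nat \<Rightarrow> complex^'n"
  assumes a: "antimono_on {1..m} a"
    and "\<And>k. k \<in> {1..m} \<Longrightarrow> (\<Sum>i=1..k. a i) \<le> (\<Sum>i=1..k. (norm (\<phi> i))\<^sup>2)"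
    and "(\<Sum>i=1..m. a i) = (\<Sum>i=1..m. (norm (\<phi> i))\<^sup>2)"
  shows "\<exists>\<psi>\<in>frames_norms m a. frame_operator m \<psi> = frame_operator m \<phi>"
  using assms(2,3)
proof (induction "card {i \<in> {1..m}. (norm (\<phi> i))\<^sup>2 \<noteq> a i}" arbitrary: \<phi> rule: less_induct)
  case less
  define x where "x i = (norm (\<phi> i))\<^sup>2" for i
  have partial: "(\<Sum>i=1..k. a i) \<le> (\<Sum>i=1..k. x i)" if "k \<in> {1..m}" for k
    using less.prems(1)[OF that] by (simp add: x_def)
  have total: "(\<Sum>i=1..m. a i) = (\<Sum>i=1..m. x i)"
    using less.prems(2) by (simp add: x_def)
  show ?case
  proof (cases "\<exists>k. k \<in> {1..m} \<and> x k < a k")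
    case False
    then have ge: "\<And>i. i \<in> {1..m} \<Longrightarrow> a i \<le> x i" by force
    have "(\<Sum>i=1..m. x i - a i) = 0" using total by (simp add: sum_subtractf)
    then have "\<forall>i\<in>{1..m}. x i - a i = 0"
      using ge by (subst (asm) sum_nonneg_eq_0_iff) auto
    then show ?thesis by (intro bexI[of _ \<phi>]) (simp_all add: frames_norms_def x_def)
  next
    case True
    define k where "k = (LEAST k. k \<in> {1..m} \<and> x k < a k)"
    have k: "k \<in> {1..m}" "x k < a k"
      using LeastI_ex[OF True] by (simp_all add: k_def)
    have before: "a i \<le> x i" if "i \<in> {1..m}" "i < k" for i
      using not_less_Least[of i "\<lambda>k. k \<in> {1..m} \<and> x k < a k"] that by (force simp: k_def)
    have "\<exists>j\<in>{1..k}. a j < x j"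
    proof (rule ccontr)
      assume "\<not> ?thesis"
      then have "(\<Sum>i=1..k. x i) < (\<Sum>i=1..k. a i)"
        using k by (intro sum_strict_mono_ex1) (auto simp: not_less intro!: bexI[of _ k])
      then show False using partial[OF k(1)] by simp
    qed
    then obtain j where j: "j \<in> {1..m}" "j < k" "a j < x j"
      using k by (metis atLeastAtMost_iff le_neq_implies_less less_asym order_trans)
    have "a k \<le> a j" using a j k by (auto simp: monotone_on_def)
    define \<delta> where "\<delta> = min (x j - a j) (a k - x k)"
    have \<delta>: "0 < \<delta>" "\<delta> \<le> x j - a j" "\<delta> \<le> a k - x k" "\<delta> = x j - a j \<or> \<delta> = a k - x k"
      using j k by (auto simp: \<delta>_def)
    have between: "(norm (\<phi> k))\<^sup>2 \<le> x j - \<delta>" "x j - \<delta> \<le> (norm (\<phi> j))\<^sup>2"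
      using \<delta> \<open>a k \<le> a j\<close> by (auto simp: x_def[symmetric])
    obtain \<psi> where \<psi>: "frame_operator m \<psi> = frame_operator m \<phi>"
      "(norm (\<psi> j))\<^sup>2 = x j - \<delta>" "(norm (\<psi> k))\<^sup>2 = (norm (\<phi> j))\<^sup>2 + (norm (\<phi> k))\<^sup>2 - (x j - \<delta>)"
      "\<And>i. i \<noteq> j \<Longrightarrow> i \<noteq> k \<Longrightarrow> \<psi> i = \<phi> i"
      by (rule transfer_norm[OF j(1) k(1) less_imp_neq[OF j(2)] between]) blast
    define y where "y i = (norm (\<psi> i))\<^sup>2" for i
    have y: "y i = x i + (if i = k then \<delta> else 0) - (if i = j then \<delta> else 0)" for i
      using \<psi> j(2) by (auto simp: y_def x_def)
    have ysum: "(\<Sum>i=1..l. y i) = (\<Sum>i=1..l. x i)" if "k \<le> l" for l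
      using that j k by (simp add: y sum_subtractf sum.distrib)
    have "{i \<in> {1..m}. y i \<noteq> a i} \<subset> {i \<in> {1..m}. x i \<noteq> a i}"
    proof
      show "{i \<in> {1..m}. y i \<noteq> a i} \<subseteq> {i \<in> {1..m}. x i \<noteq> a i}"
        using j k by (auto simp: y split: if_splits)
      have "y j = a j \<or> y k = a k" using \<delta>(4) y[of j] y[of k] j(2) by auto
      then obtain i where "i \<in> {1..m}" "y i = a i" "x i \<noteq> a i"
        using j(1,3) k by fastforce
      then show "{i \<in> {1..m}. y i \<noteq> a i} \<noteq> {i \<in> {1..m}. x i \<noteq> a i}"
        by blast
    qed
    then have "card {i \<in> {1..m}. y i \<noteq> a i} < card {i \<in> {1..m}. x i \<noteq> a i}"
      by (intro psubset_card_mono) auto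
    moreover have "(\<Sum>i=1..l. a i) \<le> (\<Sum>i=1..l. y i)" if "l \<in> {1..m}" for l
    proof (cases "k \<le> l")
      case True
      then show ?thesis using ysum partial[OF that] by simp
    next
      case False
      then show ?thesis
        using that k before y \<delta> by (intro sum_mono) auto
    qed
    moreover have "(\<Sum>i=1..m. a i) = (\<Sum>i=1..m. y i)"
      using total ysum k by simp
    ultimately show ?thesis
      using less.hyps[of \<psi>] \<psi>(1) by (simp add: x_def y_def)
  qed
qed

lemma frame_exists:
  fixes u :: "nat \<Rightarrow> complex^'n"
  assumes u: "orthonormal CARD('n) u" and l: "\<And>j. j \<in> {1..CARD('n)} \<Longrightarrow> 0 \<le> l j"
    and m: "CARD('n) \<le> m"
    and a: "antimono_on {1..m} a" "\<And>i. i \<in> {1..m} \<Longrightarrow> 0 \<le> a i"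
    and total: "(\<Sum>i=1..m. a i) = (\<Sum>j=1..CARD('n). l j)"
    and partial: "\<And>k. k \<in> {1..CARD('n)} \<Longrightarrow> (\<Sum>i=1..k. a i) \<le> (\<Sum>j=1..k. l j)"
  obtains \<phi> where "\<phi> \<in> frames_norms m a" "eigensystem (frame_operator m \<phi>) u l"
proof -
  define \<phi> where "\<phi> i = (if i \<le> CARD('n) then complex_of_real (sqrt (l i)) *s u i else 0)" for i
  have norm: "(norm (\<phi> i))\<^sup>2 = (if i \<le> CARD('n) then l i else 0)" if "1 \<le> i" for i
    using that l[of i] orthonormal_norm[OF u, of i]
    by (simp add: \<phi>_def power_mult_distrib flip: scaleR_eq_scale)
  have sum1: "(\<Sum>i=1..k. (norm (\<phi> i))\<^sup>2) = (\<Sum>j=1..min k CARD('n). l j)" for k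
    by (rule sum.mono_neutral_cong_right) (auto simp: norm)
  have "frame_operator m \<phi> *v u j = complex_of_real (l j) *s u j" if "j \<in> {1..CARD('n)}" for j
  proof -
    have "frame_operator m \<phi> *v u j = (\<Sum>i=1..m. if i = j then complex_of_real (l j) *s u j else 0)"
      unfolding frame_operator_mult
    proof (intro sum.cong refl)
      fix i assume i: "i \<in> {1..m}"
      show "cinner (u j) (\<phi> i) *s \<phi> i = (if i = j then complex_of_real (l j) *s u j else 0)"
        using that i orthonormalD[OF u that, of i] l[OF that]
        by (auto simp: \<phi>_def cinner_scale_right simp flip: of_real_mult)
    qed
    then show ?thesis using that m by simp
  qed
  then have S: "eigensystem (frame_operator m \<phi>) u l"
    using u by (simp add: eigensystem_def)
  have "(\<Sum>i=1..k. a i) \<le> (\<Sum>i=1..k. (norm (\<phi> i))\<^sup>2)" if "k \<in> {1..m}" for k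
  proof (cases "k \<le> CARD('n)")
    case True
    then show ?thesis unfolding sum1 using partial[of k] that by (simp add: min_absorb1)
  next
    case False
    have "(\<Sum>i=1..k. a i) \<le> (\<Sum>i=1..m. a i)"
      by (rule sum_mono2) (use that a(2) in auto)
    then show ?thesis unfolding sum1 using False total by (simp add: min_absorb2)
  qed
  moreover have "(\<Sum>i=1..m. a i) = (\<Sum>i=1..m. (norm (\<phi> i))\<^sup>2)"
    unfolding sum1 using total m by (simp add: min_absorb2)
  ultimately show thesis
    using prescribe_norms[OF a(1), of \<phi>] S that by metis
qed

section \<open>The optimal spectrum\<close>

lemma strictly_convex_imp_convex_on:
  assumes "strictly_convex_on I f"
  shows "convex_on I f"
proof (rule convex_onI)
  fix t x y :: real assume "0 < t" "t < 1" "x \<in> I" "y \<in> I"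
  then show "f ((1 - t) *\<^sub>R x + t *\<^sub>R y) \<le> (1 - t) * f x + t * f y"
    using assms by (cases "x = y") (fastforce simp: strictly_convex_on_def algebra_simps)+
qed (use assms in \<open>simp add: strictly_convex_on_def\<close>)

text \<open>
  The subgradient inequality is strict away from \<open>x\<close> because it would otherwise be violated at
  the midpoint of \<open>x\<close> and \<open>y\<close>.
\<close>

lemma strict_subgradient_exists:
  assumes f: "strictly_convex_on {0..} f"
  obtains g where "\<And>x y. 0 < x \<Longrightarrow> 0 \<le> y \<Longrightarrow> y \<noteq> x \<Longrightarrow> f x + g x * (y - x) < f y"
    "\<And>x y. 0 < x \<Longrightarrow> x \<le> y \<Longrightarrow> g x \<le> g y"
proof -
  define g where "g x = Inf ((\<lambda>t. (f x - f t) / (x - t)) ` ({x<..} \<inter> {0..}))" for x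
  have sub: "f x + g x * (y - x) \<le> f y" if "0 < x" "0 \<le> y" for x y
    using convex_le_Inf_differential[OF strictly_convex_imp_convex_on[OF f], of x y] that
    by (simp add: g_def)
  have strict: "f x + g x * (y - x) < f y" if "0 < x" "0 \<le> y" "y \<noteq> x" for x y
  proof -
    have "\<forall>t. x \<noteq> y \<and> 0 < t \<and> t < 1 \<longrightarrow> f ((1 - t) * x + t * y) < (1 - t) * f x + t * f y"
      using f that by (simp add: strictly_convex_on_def)
    from this[THEN spec, of "1 / 2"] have "f ((x + y) / 2) < (f x + f y) / 2"
      using that by (simp add: add_divide_distrib)
    moreover have "f x + g x * ((x + y) / 2 - x) \<le> f ((x + y) / 2)"
      using that by (intro sub) auto
    moreover have "g x * ((x + y) / 2 - x) = g x * (y - x) / 2" by (simp add: field_simps)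
    ultimately show ?thesis by (simp add: field_simps)
  qed
  moreover have "g x \<le> g y" if "0 < x" "x \<le> y" for x y
  proof (cases "x = y")
    case False
    have "0 \<le> (g y - g x) * (y - x)"
      using sub[of x y] sub[of y x] that by (simp add: algebra_simps)
    then show ?thesis using that False by (simp add: zero_le_mult_iff)
  qed simp
  ultimately show thesis by (rule that)
qed

text \<open>
  Summation by parts: the difference of the two sides is the sum of
  \<open>(g k - g (k + 1)) * (x 1 + \<dots> + x k)\<close> over \<open>k < n\<close>, so that the sign of a partial sum
  matters only where \<open>g\<close> drops.
\<close>

lemma abel_lower_bound:
  fixes g x :: "nat \<Rightarrow> real"
  assumes g: "antimono_on {1..d} g"
    and x: "\<And>k. k \<in> {1..<d} \<Longrightarrow> g k \<noteq> g (Suc k) \<Longrightarrow> 0 \<le> (\<Sum>j=1..k. x j)"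
    and "1 \<le> n" "n \<le> d"
  shows "g n * (\<Sum>j=1..n. x j) \<le> (\<Sum>j=1..n. g j * x j)"
  using assms(3,4)
proof (induction n rule: nat_induct_at_least)
  case (Suc n)
  have "g (Suc n) \<le> g n" using g Suc by (auto simp: monotone_on_def)
  then have "0 \<le> (g n - g (Suc n)) * (\<Sum>j=1..n. x j)"
    using x[of n] Suc by (cases "g n = g (Suc n)") auto
  moreover have "g n * (\<Sum>j=1..n. x j) \<le> (\<Sum>j=1..n. g j * x j)" using Suc by simp
  ultimately show ?case by (simp add: algebra_simps)
qed simp

text \<open>
  Strict subgradients at the \<open>k j\<close> reduce the inequality to a linear one. After summation by
  parts the partial sums are compared only where \<open>k\<close> drops.
\<close>

lemma sum_convex_less:
  assumes f: "strictly_convex_on {0..} f"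
    and k: "\<And>j. j \<in> {1..d} \<Longrightarrow> 0 < k j" "antimono_on {1..d} k"
    and l: "\<And>j. j \<in> {1..d} \<Longrightarrow> 0 \<le> l j"
    and total: "(\<Sum>j=1..d. k j) = (\<Sum>j=1..d. l j)"
    and partial: "\<And>n. n \<in> {1..<d} \<Longrightarrow> k n \<noteq> k (Suc n) \<Longrightarrow> (\<Sum>j=1..n. k j) \<le> (\<Sum>j=1..n. l j)"
    and ne: "\<exists>j\<in>{1..d}. l j \<noteq> k j"
  shows "(\<Sum>j=1..d. f (k j)) < (\<Sum>j=1..d. f (l j))"
proof -
  obtain g where g: "\<And>x y. 0 < x \<Longrightarrow> 0 \<le> y \<Longrightarrow> y \<noteq> x \<Longrightarrow> f x + g x * (y - x) < f y"
    and gmono: "\<And>x y. 0 < x \<Longrightarrow> x \<le> y \<Longrightarrow> g x \<le> g y"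
    using strict_subgradient_exists[OF f] by blast
  have d: "1 \<le> d" using ne by auto
  have "antimono_on {1..d} (\<lambda>j. g (k j))"
    using k gmono by (auto simp: monotone_on_def)
  then have "g (k d) * (\<Sum>j=1..d. l j - k j) \<le> (\<Sum>j=1..d. g (k j) * (l j - k j))"
  proof (rule abel_lower_bound)
    fix n assume n: "n \<in> {1..<d}" "g (k n) \<noteq> g (k (Suc n))"
    then have "k n \<noteq> k (Suc n)" by auto
    then show "0 \<le> (\<Sum>j=1..n. l j - k j)" using partial[OF n(1)] by (simp add: sum_subtractf)
  qed (use d in auto)
  then have "0 \<le> (\<Sum>j=1..d. g (k j) * (l j - k j))"
    using total by (simp add: sum_subtractf)
  then have "(\<Sum>j=1..d. f (k j)) \<le> (\<Sum>j=1..d. f (k j) + g (k j) * (l j - k j))"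
    by (simp add: sum.distrib)
  also have "\<dots> < (\<Sum>j=1..d. f (l j))"
  proof (rule sum_strict_mono_ex1)
    show "\<forall>j\<in>{1..d}. f (k j) + g (k j) * (l j - k j) \<le> f (l j)"
    proof
      fix j assume "j \<in> {1..d}"
      then show "f (k j) + g (k j) * (l j - k j) \<le> f (l j)"
        using g[of "k j" "l j"] k(1) l by (cases "l j = k j") (auto intro: less_imp_le)
    qed
    show "\<exists>j\<in>{1..d}. f (k j) + g (k j) * (l j - k j) < f (l j)"
      using ne g k(1) l by blast
  qed simp
  finally show ?thesis .
qed

locale norm_sequence =
  fixes d m :: nat and a :: "nat \<Rightarrow> real"
  assumes d: "1 \<le> d" "d \<le> m"
    and antimono: "antimono_on {1..m} a"
    and pos: "\<And>i. i \<in> {1..m} \<Longrightarrow> 0 < a i"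
begin

definition r :: nat where "r = irregularity d m a"

definition \<alpha> :: real where "\<alpha> = (\<Sum>i=r+1..m. a i) / real (d - r)"

text \<open>
  The spectrum of the frames described in part (b): the large norms survive as eigenvalues and
  the rest of the trace is spread evenly. It is majorized by the spectrum of every frame with
  the given norms.
\<close>

definition optimal :: "nat \<Rightarrow> real" where "optimal j = (if j \<le> r then a j else \<alpha>)"

lemma irregularity_props:
  shows r_less: "r < d"
    and r_irregular: "1 \<le> r \<Longrightarrow> (\<Sum>i=r+1..m. a i) < real (d - r) * a r"
    and r_maximal: "r < j \<Longrightarrow> j < d \<Longrightarrow> real (d - j) * a j \<le> (\<Sum>i=j+1..m. a i)"
proof -
  define J where "J = {j \<in> {1..d - 1}. real (d - j) * a j > (\<Sum>i=j+1..m. a i)}"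
  have J: "finite J" by (simp add: J_def)
  have r: "r = (if J = {} then 0 else Max J)"
    by (simp only: r_def irregularity_def J_def Let_def)
  have mem: "r \<in> J" if "r \<noteq> 0" using that J r by (metis Max_in)
  have top: "j \<le> r" if "j \<in> J" for j using that J r by auto
  show "r < d" using mem d by (cases "r = 0") (auto simp: J_def)
  show "1 \<le> r \<Longrightarrow> (\<Sum>i=r+1..m. a i) < real (d - r) * a r"
    using mem by (auto simp: J_def)
  show "real (d - j) * a j \<le> (\<Sum>i=j+1..m. a i)" if "r < j" "j < d"
    using top[of j] that by (force simp: J_def)
qed

lemma a_antimono: "1 \<le> i \<Longrightarrow> i \<le> j \<Longrightarrow> j \<le> m \<Longrightarrow> a j \<le> a i"
  using antimono by (simp add: monotone_on_def)

lemma alpha_pos: "0 < \<alpha>"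
  using r_less d pos by (auto simp: \<alpha>_def intro!: divide_pos_pos sum_pos)

lemma alpha_times: "real (d - r) * \<alpha> = (\<Sum>i=r+1..m. a i)"
  using r_less by (simp add: \<alpha>_def)

lemma alpha_less:
  assumes "i \<in> {1..r}"
  shows "\<alpha> < a i"
proof -
  have "real (d - r) * \<alpha> < real (d - r) * a r"
    using r_irregular assms by (simp add: alpha_times)
  then have "\<alpha> < a r" using r_less by simp
  also have "a r \<le> a i" using assms r_less d by (intro a_antimono) auto
  finally show ?thesis .
qed

text \<open>
  Maximality of \<open>r\<close> bounds \<open>a (r + 1)\<close>, by splitting off the first summand of the tail, and
  later norms are no larger. For \<open>r + 1 = d\<close> the value \<open>\<alpha>\<close> is the whole tail.
\<close>

lemma le_alpha:
  assumes "i \<in> {r+1..m}"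
  shows "a i \<le> \<alpha>"
proof -
  have "real (d - r) * a (r+1) \<le> (\<Sum>i=r+1..m. a i)"
  proof (cases "r + 1 < d")
    case True
    have "(\<Sum>i=r+1..m. a i) = a (r+1) + (\<Sum>i=r+1+1..m. a i)"
      using True d by (simp add: sum.atLeast_Suc_atMost)
    moreover have "real (d - r) * a (r+1) = a (r+1) + real (d - (r+1)) * a (r+1)"
      using True by (simp add: of_nat_diff algebra_simps)
    ultimately show ?thesis using r_maximal[of "r+1"] True by simp
  next
    case False
    then have "d - r = 1" using r_less by simp
    moreover have "a (r+1) \<le> (\<Sum>i=r+1..m. a i)"
      by (rule member_le_sum) (use pos d r_less in \<open>auto intro: less_imp_le\<close>)
    ultimately show ?thesis by simp
  qed
  also have "\<dots> = real (d - r) * \<alpha>" by (simp add: alpha_times)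
  finally have "a (r+1) \<le> \<alpha>" using r_less by simp
  moreover have "a i \<le> a (r+1)" using assms by (intro a_antimono) auto
  ultimately show ?thesis by simp
qed

lemma optimal_pos: "j \<in> {1..d} \<Longrightarrow> 0 < optimal j"
  using alpha_pos pos d by (auto simp: optimal_def)

lemma optimal_antimono: "antimono_on {1..d} optimal"
proof (rule monotone_onI)
  fix i j assume "i \<in> {1..d}" "j \<in> {1..d}" "i \<le> j"
  then show "optimal i \<ge> optimal j"
    using alpha_less[of i] a_antimono[of i j] d by (auto simp: optimal_def)
qed

lemma optimal_sum_le_r: "k \<le> r \<Longrightarrow> (\<Sum>j=1..k. optimal j) = (\<Sum>i=1..k. a i)"
  by (simp add: optimal_def)

lemma sum_optimal_split:
  assumes "r \<le> k"
  shows "(\<Sum>j=1..k. optimal j) = (\<Sum>i=1..r. a i) + real (k - r) * \<alpha>"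
proof -
  have "(\<Sum>j=1..k. optimal j) = (\<Sum>j=1..r. optimal j) + (\<Sum>j=r+1..k. optimal j)"
    using assms sum.ub_add_nat[of 1 r optimal "k - r"] by simp
  then show ?thesis by (simp add: optimal_def)
qed

lemma sum_a_split: "r \<le> k \<Longrightarrow> (\<Sum>i=1..k. a i) = (\<Sum>i=1..r. a i) + (\<Sum>i=r+1..k. a i)"
  using sum.ub_add_nat[of 1 r a "k - r"] by simp

lemma optimal_total: "(\<Sum>j=1..d. optimal j) = (\<Sum>i=1..m. a i)"
  using r_less d by (simp only: sum_optimal_split[of d] sum_a_split[of m] alpha_times)

lemma optimal_partial:
  assumes "k \<in> {1..d}"
  shows "(\<Sum>i=1..k. a i) \<le> (\<Sum>j=1..k. optimal j)"
proof (cases "k \<le> r")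
  case False
  have "(\<Sum>i=r+1..k. a i) \<le> (\<Sum>i=r+1..k. \<alpha>)"
    by (rule sum_mono) (use le_alpha assms d in auto)
  then show ?thesis using False sum_a_split[of k] sum_optimal_split[of k] by simp
qed (use optimal_sum_le_r[of k] in simp)

text \<open>
  A drop of the optimal spectrum occurs only at places \<open>n \<le> r\<close>, and there its partial sums are
  those of \<open>a\<close>.
\<close>

lemma sum_optimal_less:
  assumes f: "strictly_convex_on {0..} f"
    and l: "\<And>j. j \<in> {1..d} \<Longrightarrow> 0 \<le> l j"
    and total: "(\<Sum>j=1..d. l j) = (\<Sum>i=1..m. a i)"
    and partial: "\<And>k. k \<in> {1..d} \<Longrightarrow> (\<Sum>i=1..k. a i) \<le> (\<Sum>j=1..k. l j)"
    and ne: "\<exists>j\<in>{1..d}. l j \<noteq> optimal j"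
  shows "(\<Sum>j=1..d. f (optimal j)) < (\<Sum>j=1..d. f (l j))"
proof (rule sum_convex_less[OF f optimal_pos optimal_antimono l _ _ ne])
  show "(\<Sum>j=1..n. optimal j) \<le> (\<Sum>j=1..n. l j)"
    if "n \<in> {1..<d}" "optimal n \<noteq> optimal (Suc n)" for n
  proof -
    have "n \<le> r" using that by (auto simp: optimal_def split: if_splits)
    then show ?thesis using partial[of n] optimal_sum_le_r[of n] that by simp
  qed
qed (simp_all only: optimal_total total)

end

section \<open>Minimizers with prescribed norms\<close>

lemma operator_dist_le:
  fixes S T :: "complex^'n^'n"
  assumes S: "eigensystem S u l" and T: "eigensystem T u k"
  shows "operator_dist S T \<le> (\<Sum>j=1..CARD('n). \<bar>l j - k j\<bar>)"
  unfolding operator_dist_def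
proof (rule onorm_le)
  fix x :: "complex^'n"
  note u = eigensystem_orthonormal[OF S]
  have "(S - T) *v x = (\<Sum>j=1..CARD('n). (of_real (l j - k j) * cinner x (u j)) *s u j)"
    by (simp add: matrix_vector_mult_diff_rdistrib eigensystem_mult[OF S] eigensystem_mult[OF T]
        left_diff_distrib vector_sub_rdistrib sum_subtractf)
  then have "norm ((S - T) *v x) \<le>
      (\<Sum>j=1..CARD('n). norm ((of_real (l j - k j) * cinner x (u j)) *s u j))"
    by (simp only: norm_sum)
  also have "\<dots> \<le> (\<Sum>j=1..CARD('n). \<bar>l j - k j\<bar> * norm x)"
  proof (rule sum_mono)
    fix j assume j: "j \<in> {1..CARD('n)}"
    have "norm ((of_real (l j - k j) * cinner x (u j)) *s u j) = \<bar>l j - k j\<bar> * cmod (cinner x (u j))"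
      by (simp only: norm_scale norm_mult norm_of_real orthonormal_norm[OF u j] mult_1_right)
    also have "\<dots> \<le> \<bar>l j - k j\<bar> * norm x"
      by (intro mult_left_mono cinner_le_orthonormal[OF u j]) simp
    finally show "norm ((of_real (l j - k j) * cinner x (u j)) *s u j) \<le> \<bar>l j - k j\<bar> * norm x" .
  qed
  finally show "norm ((S - T) *v x) \<le> (\<Sum>j=1..CARD('n). \<bar>l j - k j\<bar>) * norm x"
    by (simp add: sum_distrib_right)
qed

locale prescribed_frame = norm_sequence "CARD('n)" m a
  for m :: nat and a :: "nat \<Rightarrow> real" +
  fixes \<phi> :: "nat \<Rightarrow> complex^'n" and u :: "nat \<Rightarrow> complex^'n" and l :: "nat \<Rightarrow> real"
  assumes norms: "\<phi> \<in> frames_norms m a"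
    and S: "eigensystem (frame_operator m \<phi>) u l"
    and sorted: "antimono_on {1..CARD('n)} l"
begin

lemma norm_phi: "i \<in> {1..m} \<Longrightarrow> (norm (\<phi> i))\<^sup>2 = a i"
  using norms by (simp add: frames_norms_def)

lemma eigenvalues_total: "(\<Sum>j=1..CARD('n). l j) = (\<Sum>i=1..m. a i)"
  using eigenvalue_sum[OF S] norm_phi by simp

lemma eigenvalues_partial:
  assumes "k \<in> {1..CARD('n)}"
  shows "(\<Sum>i=1..k. a i) \<le> (\<Sum>j=1..k. l j)"
proof -
  have "(\<Sum>i=1..k. (norm (\<phi> i))\<^sup>2) \<le> (\<Sum>j=1..k. l j)"
    using sum_norms_le_sum_eigenvalues[OF S sorted assms] assms d by auto
  moreover have "(\<Sum>i=1..k. (norm (\<phi> i))\<^sup>2) = (\<Sum>i=1..k. a i)"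
    using assms d by (intro sum.cong refl norm_phi) auto
  ultimately show ?thesis by simp
qed

lemma optimal_less:
  assumes "strictly_convex_on {0..} f" "\<exists>j\<in>{1..CARD('n)}. l j \<noteq> optimal j"
  shows "(\<Sum>j=1..CARD('n). f (optimal j)) < tr_fun f (frame_operator m \<phi>)"
  unfolding tr_fun_eigensystem[OF S]
  using sum_optimal_less[OF assms(1) eigenvalue_nonneg[OF S] eigenvalues_total
    eigenvalues_partial assms(2)] .

lemma optimal_le:
  assumes "strictly_convex_on {0..} f"
  shows "(\<Sum>j=1..CARD('n). f (optimal j)) \<le> tr_fun f (frame_operator m \<phi>)"
proof (cases "\<exists>j\<in>{1..CARD('n)}. l j \<noteq> optimal j")
  case True
  then show ?thesis using optimal_less[OF assms] by simp
qed (simp add: tr_fun_eigensystem[OF S])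

text \<open>
  Moving the spectrum along the segment towards the optimal one keeps the eigenvectors and
  the conditions on partial sums, which are linear; hence every point of the segment is the
  spectrum of an operator with the same prescribed norms, and convexity makes the potential
  smaller as soon as the segment is left at its first end.
\<close>

lemma local_minimizer_optimal:
  assumes f: "strictly_convex_on {0..} f"
    and min: "local_minimizer (tr_fun f) (frame_operators_norms m a) operator_dist
      (frame_operator m \<phi>)"
    and j: "j \<in> {1..CARD('n)}"
  shows "l j = optimal j"
proof (rule ccontr)
  assume ne: "l j \<noteq> optimal j"
  obtain \<epsilon> where \<epsilon>: "0 < \<epsilon>"
    and le: "\<And>T. T \<in> frame_operators_norms m a \<Longrightarrow> operator_dist (frame_operator m \<phi>) T < \<epsilon> \<Longrightarrow>
      tr_fun f (frame_operator m \<phi>) \<le> tr_fun f T"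
    using min by (auto simp: local_minimizer_def)
  define K where "K = (\<Sum>j=1..CARD('n). \<bar>l j - optimal j\<bar>)"
  have K: "0 \<le> K" by (simp add: K_def sum_nonneg)
  \<comment> \<open>Any \<open>t\<close> between 0 and 1 with \<open>t * K < \<epsilon>\<close> will do.\<close>
  define t where "t = \<epsilon> / (K + 1 + \<epsilon>)"
  have t: "0 < t" "t < 1" "t * K < \<epsilon>"
    using \<epsilon> K by (simp_all add: t_def field_simps) (smt (verit) mult_pos_pos)
  define k where "k j = (1 - t) * l j + t * optimal j" for j
  have k_sum: "(\<Sum>j=1..n. k j) = (1 - t) * (\<Sum>j=1..n. l j) + t * (\<Sum>j=1..n. optimal j)" for n
    by (simp add: k_def sum.distrib sum_distrib_left)
  have nonneg: "0 \<le> k j" if "j \<in> {1..CARD('n)}" for j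
    using eigenvalue_nonneg[OF S that] optimal_pos[OF that] t by (simp add: k_def)
  have total: "(\<Sum>i=1..m. a i) = (\<Sum>j=1..CARD('n). k j)"
    unfolding k_sum eigenvalues_total optimal_total by (simp add: algebra_simps)
  have partial: "(\<Sum>i=1..n. a i) \<le> (\<Sum>j=1..n. k j)" if "n \<in> {1..CARD('n)}" for n
  proof -
    have "(\<Sum>i=1..n. a i) = (1 - t) * (\<Sum>i=1..n. a i) + t * (\<Sum>i=1..n. a i)"
      by (simp add: algebra_simps)
    also have "\<dots> \<le> (\<Sum>j=1..n. k j)"
      unfolding k_sum using t eigenvalues_partial[OF that] optimal_partial[OF that]
      by (intro add_mono mult_left_mono) auto
    finally show ?thesis .
  qed
  obtain \<psi> where \<psi>: "\<psi> \<in> frames_norms m a" "eigensystem (frame_operator m \<psi>) u k"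
    using frame_exists[OF eigensystem_orthonormal[OF S] nonneg d(2) antimono
      less_imp_le[OF pos] total partial] by blast
  have "operator_dist (frame_operator m \<phi>) (frame_operator m \<psi>) \<le> (\<Sum>j=1..CARD('n). \<bar>l j - k j\<bar>)"
    by (rule operator_dist_le[OF S \<psi>(2)])
  also have "\<dots> = (\<Sum>j=1..CARD('n). t * \<bar>l j - optimal j\<bar>)"
  proof (intro sum.cong refl)
    fix j
    have "l j - k j = t * (l j - optimal j)" by (simp add: k_def algebra_simps)
    then show "\<bar>l j - k j\<bar> = t * \<bar>l j - optimal j\<bar>" using t by (simp add: abs_mult)
  qed
  also have "\<dots> < \<epsilon>" using t by (simp add: K_def flip: sum_distrib_left)
  finally have "tr_fun f (frame_operator m \<phi>) \<le> tr_fun f (frame_operator m \<psi>)"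
    using le \<psi>(1) by (simp add: frame_operators_norms_def)
  moreover have "tr_fun f (frame_operator m \<psi>) \<le>
      (\<Sum>j=1..CARD('n). (1 - t) * f (l j) + t * f (optimal j))"
    unfolding tr_fun_eigensystem[OF \<psi>(2)]
  proof (rule sum_mono)
    fix j assume j: "j \<in> {1..CARD('n)}"
    show "f (k j) \<le> (1 - t) * f (l j) + t * f (optimal j)"
      using convex_onD[OF strictly_convex_imp_convex_on[OF f], of t "l j" "optimal j"] t
        eigenvalue_nonneg[OF S j] optimal_pos[OF j] by (simp add: k_def)
  qed
  moreover have "\<dots> = (1 - t) * tr_fun f (frame_operator m \<phi>) + t * (\<Sum>j=1..CARD('n). f (optimal j))"
    by (simp add: tr_fun_eigensystem[OF S] sum.distrib sum_distrib_left)
  moreover have "t * (\<Sum>j=1..CARD('n). f (optimal j)) < t * tr_fun f (frame_operator m \<phi>)"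
    using optimal_less[OF f] bexI[of "\<lambda>j. l j \<noteq> optimal j", OF ne j] t by simp
  ultimately show False by (simp add: left_diff_distrib)
qed

end

locale optimal_frame = prescribed_frame m a \<phi> u l
  for m a and \<phi> :: "nat \<Rightarrow> complex^'n" and u l +
  assumes opt: "j \<in> {1..CARD('n)} \<Longrightarrow> l j = norm_sequence.optimal CARD('n) m a j"
begin

abbreviation "T \<equiv> frame_operator m \<phi>"

text \<open>
  By Ky Fan's inequality the first \<open>i\<close> unit vectors \<open>\<phi>\<^sub>j / \<parallel>\<phi>\<^sub>j\<parallel>\<close>, orthogonal by induction,
  carry at most \<open>a 1 + \<dots> + a i\<close> of the frame operator. But \<open>\<phi>\<^sub>j\<close> alone contributes \<open>a j\<close> to
  the value on its own direction, which leaves nothing for the other frame vectors.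
\<close>

lemma phi_orthogonal:
  assumes "i \<in> {1..r}" "k \<in> {1..m}" "k \<noteq> i"
  shows "cinner (\<phi> i) (\<phi> k) = 0"
  using assms
proof (induction i arbitrary: k rule: less_induct)
  case (less i)
  have im: "{1..i} \<subseteq> {1..m}" "i \<in> {1..CARD('n)}" using less.prems(1) r_less d by auto
  have a0: "0 < a j" if "j \<in> {1..i}" for j using that pos im by blast
  define x where "x j = complex_of_real (1 / sqrt (a j)) *s \<phi> j" for j
  have "cinner (\<phi> j) (\<phi> k) = 0" if "j \<in> {1..i}" "k \<in> {1..i}" "j \<noteq> k" for j k
  proof (cases "j < k")
    case True
    then show ?thesis using less.IH[of j k] that im less.prems(1) by auto
  next
    case False
    then have "cinner (\<phi> k) (\<phi> j) = 0" using less.IH[of k j] that im less.prems(1) by auto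
    then show ?thesis by (metis cnj_cinner complex_cnj_zero)
  qed
  moreover have xx: "cinner (x j) (x j) = 1" if "j \<in> {1..i}" for j
    unfolding x_def using that im by (intro cinner_normalize norm_phi a0) auto
  ultimately have x: "orthonormal i x"
    by (auto simp: orthonormal_def x_def cinner_scale_left cinner_scale_right)
  define Q where "Q j = (\<Sum>k=1..m. (cmod (cinner (\<phi> j) (\<phi> k)))\<^sup>2)" for j
  have TQ: "Re (cinner (T *v x j) (x j)) = Q j / a j" if "j \<in> {1..i}" for j
    using a0[OF that]
    by (simp add: x_def frame_quad cinner_scale_left norm_mult power_mult_distrib power_divide Q_def
        norm_divide sum_divide_distrib)
  have phi2: "(cmod (cinner (\<phi> j) (\<phi> j)))\<^sup>2 = a j * a j" if "j \<in> {1..m}" for j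
    using norm_phi[OF that] by (simp add: cinner_self norm_power power2_eq_square)
  have Q: "Q j = a j * a j + (\<Sum>k\<in>{1..m} - {j}. (cmod (cinner (\<phi> j) (\<phi> k)))\<^sup>2)"
    if "j \<in> {1..m}" for j
    unfolding Q_def by (subst sum.remove[of _ j]) (use that phi2 in simp_all)
  have ge: "a j \<le> Q j / a j" if "j \<in> {1..i}" for j
  proof -
    have "a j * a j \<le> Q j" using Q[of j] that im by (auto intro!: sum_nonneg)
    then show ?thesis using a0[OF that] by (simp add: pos_le_divide_eq)
  qed
  have "(\<Sum>j=1..i. Q j / a j) \<le> (\<Sum>j=1..i. l j)"
    using ky_fan[OF S sorted eigenvalue_nonneg[OF S] x im(2)] TQ by simp
  also have "\<dots> = (\<Sum>j=1..i. a j)"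
    using less.prems(1) im(2) by (intro sum.cong refl) (auto simp: opt optimal_def)
  finally have "(\<Sum>j=1..i. Q j / a j - a j) \<le> 0" by (simp add: sum_subtractf)
  then have "(\<Sum>j=1..i. Q j / a j - a j) = 0"
    using ge by (intro antisym sum_nonneg) auto
  then have "Q i / a i = a i"
    using ge less.prems(1) by (subst (asm) sum_nonneg_eq_0_iff) auto
  then have "Q i = a i * a i" using a0[of i] less.prems(1) by (simp add: field_simps)
  then have "(\<Sum>k\<in>{1..m} - {i}. (cmod (cinner (\<phi> i) (\<phi> k)))\<^sup>2) = 0"
    using Q[of i] im less.prems(1) by auto
  then show ?case using less.prems(2,3) by (simp add: sum_nonneg_eq_0_iff)
qed

lemma phi_orthogonal': "i \<in> {1..r} \<Longrightarrow> k \<in> {1..m} \<Longrightarrow> k \<noteq> i \<Longrightarrow> cinner (\<phi> k) (\<phi> i) = 0"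
  using phi_orthogonal[of i k] by (metis cnj_cinner complex_cnj_zero)

lemma phi_eigenvector:
  assumes "i \<in> {1..r}"
  shows "T *v \<phi> i = complex_of_real (a i) *s \<phi> i"
proof -
  have i: "i \<in> {1..m}" using assms r_less d by auto
  have "T *v \<phi> i = cinner (\<phi> i) (\<phi> i) *s \<phi> i + (\<Sum>k\<in>{1..m} - {i}. cinner (\<phi> i) (\<phi> k) *s \<phi> k)"
    unfolding frame_operator_mult using i by (simp add: sum.remove)
  also have "(\<Sum>k\<in>{1..m} - {i}. cinner (\<phi> i) (\<phi> k) *s \<phi> k) = 0"
    using phi_orthogonal[OF assms] by (intro sum.neutral) simp
  finally show ?thesis using norm_phi[OF i] by (simp add: cinner_self flip: of_real_power)
qed

lemma alpha_eigenvector: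
  assumes "j \<in> {r+1..CARD('n)}"
  shows "T *v u j = complex_of_real \<alpha> *s u j"
  using S opt[of j] assms by (simp add: eigensystem_def optimal_def)

text \<open>These are eigenvectors of a self-adjoint operator for the eigenvalues \<open>a i > \<alpha>\<close>.\<close>

lemma phi_orthogonal_u:
  assumes "i \<in> {1..r}" "j \<in> {r+1..CARD('n)}"
  shows "cinner (\<phi> i) (u j) = 0"
proof -
  have "of_real (a i) * cinner (\<phi> i) (u j) = cinner (T *v \<phi> i) (u j)"
    by (simp add: phi_eigenvector[OF assms(1)] cinner_scale_left)
  also have "\<dots> = of_real \<alpha> * cinner (\<phi> i) (u j)"
    by (simp add: frame_operator_selfadjoint alpha_eigenvector[OF assms(2)] cinner_scale_right)
  finally show ?thesis using alpha_less[OF assms(1)] by simp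
qed

text \<open>
  The frame vectors with large norm need not be multiples of \<open>u 1, \<dots>, u r\<close> when some of these
  norms coincide, so they replace those eigenvectors.
\<close>

definition e :: "nat \<Rightarrow> complex^'n" where
  "e j = (if j \<le> r then complex_of_real (1 / sqrt (a j)) *s \<phi> j else u j)"

lemma phi_eq: "i \<in> {1..r} \<Longrightarrow> \<phi> i = sqrt (a i) *\<^sub>R e i"
  using pos[of i] r_less d by (simp add: e_def scaleR_eq_scale vector_smult_assoc flip: of_real_mult)

lemma e_orthonormal: "orthonormal CARD('n) e"
  unfolding orthonormal_def
proof (intro ballI)
  fix i j assume ij: "i \<in> {1..CARD('n)}" "j \<in> {1..CARD('n)}"
  have u: "orthonormal CARD('n) u" by (rule eigensystem_orthonormal[OF S])
  consider "i \<le> r" "j \<le> r" "i = j" | "i \<le> r" "j \<le> r" "i \<noteq> j" | "i \<le> r" "r < j"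
    | "r < i" "j \<le> r" | "r < i" "r < j" by linarith
  then show "cinner (e i) (e j) = (if i = j then 1 else 0)"
  proof cases
    case 1
    have "cinner (complex_of_real (1 / sqrt (a i)) *s \<phi> i) (complex_of_real (1 / sqrt (a i)) *s \<phi> i) = 1"
      using ij d by (intro cinner_normalize norm_phi pos) auto
    then show ?thesis using 1 by (simp add: e_def)
  next
    case 2
    then show ?thesis using phi_orthogonal[of i j] ij d
      by (simp add: e_def cinner_scale_left cinner_scale_right)
  next
    case 3
    then show ?thesis using phi_orthogonal_u[of i j] ij by (simp add: e_def cinner_scale_left)
  next
    case 4
    then have "cinner (u i) (\<phi> j) = 0"
      using phi_orthogonal_u[of j i] ij cnj_cinner[of "\<phi> j" "u i"] by simp
    then show ?thesis using 4 by (simp add: e_def cinner_scale_right)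
  next
    case 5
    then show ?thesis using orthonormalD[OF u ij] by (simp add: e_def)
  qed
qed

lemma span_e:
  assumes "x \<in> vec.span (e ` {r+1..CARD('n)})"
  shows "T *v x = complex_of_real \<alpha> *s x" "i \<in> {1..r} \<Longrightarrow> cinner x (\<phi> i) = 0"
proof -
  let ?W = "{x. T *v x = complex_of_real \<alpha> *s x \<and> (\<forall>i\<in>{1..r}. cinner x (\<phi> i) = 0)}"
  have "vec.subspace ?W"
    by (rule vec.subspaceI) (auto simp: matrix_vector_right_distrib vector_add_ldistrib
        vector_scalar_commute cinner_add_left cinner_scale_left vector_smult_assoc mult.commute)
  moreover have "e ` {r+1..CARD('n)} \<subseteq> ?W"
  proof clarify
    fix j assume j: "j \<in> {r+1..CARD('n)}"
    have "cinner (u j) (\<phi> i) = 0" if "i \<in> {1..r}" for i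
      using phi_orthogonal_u[OF that j] cnj_cinner[of "\<phi> i" "u j"] by simp
    then show "T *v e j = complex_of_real \<alpha> *s e j \<and> (\<forall>i\<in>{1..r}. cinner (e j) (\<phi> i) = 0)"
      using j alpha_eigenvector[OF j] by (simp add: e_def)
  qed
  ultimately have "vec.span (e ` {r+1..CARD('n)}) \<subseteq> ?W" by (intro vec.span_minimal)
  then show "T *v x = complex_of_real \<alpha> *s x" "i \<in> {1..r} \<Longrightarrow> cinner x (\<phi> i) = 0"
    using assms by auto
qed

lemma tight_rest: "tight_frame_for {r+1..m} \<phi> (vec.span (e ` {r+1..CARD('n)}))"
  unfolding tight_frame_for_def
proof (intro conjI ballI exI[of _ \<alpha>])
  fix i assume i: "i \<in> {r+1..m}"
  have "\<phi> i = (\<Sum>j=1..CARD('n). cinner (\<phi> i) (e j) *s e j)"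
    by (rule orthonormal_expansion[OF e_orthonormal])
  also have "\<dots> \<in> vec.span (e ` {r+1..CARD('n)})"
  proof (rule vec.span_sum)
    fix j assume j: "j \<in> {1..CARD('n)}"
    show "cinner (\<phi> i) (e j) *s e j \<in> vec.span (e ` {r+1..CARD('n)})"
    proof (cases "j \<le> r")
      case True
      then have "cinner (\<phi> i) (e j) = 0"
        using phi_orthogonal'[of j i] i j by (simp add: e_def cinner_scale_right)
      then show ?thesis by (simp add: vec.span_zero)
    next
      case False
      then show ?thesis using j by (intro vec.span_scale vec.span_base imageI) auto
    qed
  qed
  finally show "\<phi> i \<in> vec.span (e ` {r+1..CARD('n)})" .
next
  fix x assume x: "x \<in> vec.span (e ` {r+1..CARD('n)})"
  have "(\<Sum>i\<in>{r+1..m}. (cmod (cinner x (\<phi> i)))\<^sup>2) = (\<Sum>i=1..m. (cmod (cinner x (\<phi> i)))\<^sup>2)"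
    using span_e(2)[OF x] by (intro sum.mono_neutral_left) auto
  also have "\<dots> = Re (cinner (T *v x) x)" by (simp add: frame_quad)
  also have "\<dots> = \<alpha> * (norm x)\<^sup>2" by (simp add: span_e(1)[OF x] cinner_scale_left Re_cinner_self)
  finally show "(\<Sum>i\<in>{r+1..m}. (cmod (cinner x (\<phi> i)))\<^sup>2) = \<alpha> * (norm x)\<^sup>2" .
qed (simp_all add: alpha_pos)

end

section \<open>Minimizers with prescribed total norm\<close>

lemma eigensystem_iff_gram:
  fixes \<phi> :: "nat \<Rightarrow> complex^'n"
  assumes u: "orthonormal CARD('n) u"
  shows "eigensystem (frame_operator m \<phi>) u l \<longleftrightarrow>
    (\<forall>j\<in>{1..CARD('n)}. \<forall>k\<in>{1..CARD('n)}.
      (\<Sum>i=1..m. cinner (\<phi> i) (u k) * cnj (cinner (\<phi> i) (u j))) =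
      (if j = k then complex_of_real (l j) else 0))"
proof -
  let ?T = "frame_operator m \<phi>"
  have gram: "(\<Sum>i=1..m. cinner (\<phi> i) (u k) * cnj (cinner (\<phi> i) (u j))) = cinner (?T *v u j) (u k)"
    for j k
    by (simp add: frame_operator_mult cinner_sum_left cinner_scale_left cnj_cinner mult.commute)
  have "?T *v u j = complex_of_real (l j) *s u j \<longleftrightarrow>
      (\<forall>k\<in>{1..CARD('n)}. cinner (?T *v u j) (u k) = (if j = k then complex_of_real (l j) else 0))"
    if j: "j \<in> {1..CARD('n)}" for j
  proof
    assume "?T *v u j = complex_of_real (l j) *s u j"
    then show "\<forall>k\<in>{1..CARD('n)}. cinner (?T *v u j) (u k) = (if j = k then complex_of_real (l j) else 0)"
      using orthonormalD[OF u j] by (simp add: cinner_scale_left)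
  next
    assume *: "\<forall>k\<in>{1..CARD('n)}. cinner (?T *v u j) (u k) = (if j = k then complex_of_real (l j) else 0)"
    have "?T *v u j = (\<Sum>k=1..CARD('n). cinner (?T *v u j) (u k) *s u k)"
      by (rule orthonormal_expansion[OF u])
    also have "\<dots> = (\<Sum>k=1..CARD('n). if k = j then complex_of_real (l j) *s u j else 0)"
      using * by (intro sum.cong) auto
    finally show "?T *v u j = complex_of_real (l j) *s u j" using j by simp
  qed
  then show ?thesis unfolding gram eigensystem_def using u by simp
qed

lemma sqrt_diff_square_le:
  assumes "0 \<le> x" "x \<le> y"
  shows "(sqrt y - sqrt x)\<^sup>2 \<le> y - x"
proof -
  have "sqrt x * sqrt x \<le> sqrt x * sqrt y" using assms by (intro mult_left_mono) auto
  then show ?thesis using assms by (simp add: power2_diff) (simp add: mult.commute)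
qed

lemma rescale_column:
  fixes b :: "nat \<Rightarrow> complex"
  assumes "(\<Sum>i=1..m. (cmod (b i))\<^sup>2) = x" "0 < x" "0 \<le> y"
  defines "s \<equiv> sqrt (y / x)"
  shows "(\<Sum>i=1..m. (cmod (of_real s * b i))\<^sup>2) = y"
    and "(\<Sum>i=1..m. (cmod (of_real s * b i - b i))\<^sup>2) \<le> \<bar>y - x\<bar>"
proof -
  have scale: "(\<Sum>i=1..m. (cmod (of_real k * b i))\<^sup>2) = k\<^sup>2 * x" for k
    unfolding assms(1)[symmetric] by (simp add: norm_mult power_mult_distrib flip: sum_distrib_left)
  show "(\<Sum>i=1..m. (cmod (of_real s * b i))\<^sup>2) = y"
    unfolding scale using assms by (simp add: s_def)
  have "(\<Sum>i=1..m. (cmod (of_real s * b i - b i))\<^sup>2) = (s - 1)\<^sup>2 * x"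
    using scale[of "s - 1"] by (simp add: left_diff_distrib)
  also have "\<dots> = ((s - 1) * sqrt x)\<^sup>2" using assms by (simp add: power_mult_distrib)
  also have "(s - 1) * sqrt x = sqrt y - sqrt x"
    using assms by (simp add: s_def real_sqrt_divide left_diff_distrib)
  also have "(sqrt y - sqrt x)\<^sup>2 \<le> \<bar>y - x\<bar>"
  proof (cases "x \<le> y")
    case True
    then show ?thesis using sqrt_diff_square_le[of x y] assms by simp
  next
    case False
    then show ?thesis using sqrt_diff_square_le[of y x] assms by (simp add: power2_commute)
  qed
  finally show "(\<Sum>i=1..m. (cmod (of_real s * b i - b i))\<^sup>2) \<le> \<bar>y - x\<bar>" .
qed

text \<open>
  A positive eigenvalue is increased by rescaling the coordinates along its eigenvector. If the
  eigenvalue is 0 then these coordinates vanish, and the \<open>m \<ge> d\<close> frame vectors, lying in a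
  hyperplane, have a linear dependency; its conjugate provides new coordinates.
\<close>

lemma increase_column:
  fixes \<phi> :: "nat \<Rightarrow> complex^'n"
  assumes T: "eigensystem (frame_operator m \<phi>) u l" and m: "CARD('n) \<le> m"
    and q: "q \<in> {1..CARD('n)}" and t: "0 \<le> t"
  obtains z where "(\<Sum>i=1..m. (cmod (z i))\<^sup>2) = l q + t"
    "(\<Sum>i=1..m. (cmod (z i - cinner (\<phi> i) (u q)))\<^sup>2) \<le> t"
    "\<And>j. j \<in> {1..CARD('n)} \<Longrightarrow> j \<noteq> q \<Longrightarrow> (\<Sum>i=1..m. z i * cnj (cinner (\<phi> i) (u j))) = 0"
proof -
  note u = eigensystem_orthonormal[OF T]
  have lq: "(\<Sum>i=1..m. (cmod (cinner (\<phi> i) (u q)))\<^sup>2) = l q"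
    using eigenvalue_eq[OF T q] by (simp add: cmod_cinner_commute)
  show thesis
  proof (cases "l q = 0")
    case False
    then have pos: "0 < l q" using eigenvalue_nonneg[OF T q] by simp
    define s where "s = sqrt ((l q + t) / l q)"
    note scaled = rescale_column[of "\<lambda>i. cinner (\<phi> i) (u q)" m "l q" "l q + t", OF lq pos, folded s_def]
    show thesis
    proof (rule that[of "\<lambda>i. of_real s * cinner (\<phi> i) (u q)"])
      fix j assume j: "j \<in> {1..CARD('n)}" "j \<noteq> q"
      have "(\<Sum>i=1..m. cinner (\<phi> i) (u q) * cnj (cinner (\<phi> i) (u j))) = 0"
        using eigensystem_iff_gram[OF u, THEN iffD1, OF T] q j by simp
      then show "(\<Sum>i=1..m. of_real s * cinner (\<phi> i) (u q) * cnj (cinner (\<phi> i) (u j))) = 0"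
        by (simp add: mult.assoc flip: sum_distrib_left)
    qed (use scaled t pos in simp_all)
  next
    case True
    then have zero: "cinner (\<phi> i) (u q) = 0" if "i \<in> {1..m}" for i
      using lq that by (simp add: sum_nonneg_eq_0_iff)
    have "u q \<noteq> 0" using orthonormal_norm[OF u q] by auto
    then obtain w where w: "(\<Sum>i=1..m. (cmod (w i))\<^sup>2) = (1::real)" "(\<Sum>i=1..m. w i *s \<phi> i) = 0"
      by (rule dependency_exists[OF m _ zero])
    have norm: "(\<Sum>i=1..m. (cmod (of_real (sqrt t) * cnj (w i)))\<^sup>2) = t"
      using w(1) t by (simp add: norm_mult power_mult_distrib flip: sum_distrib_left)
    show thesis
    proof (rule that[of "\<lambda>i. of_real (sqrt t) * cnj (w i)"])
      fix j
      have "(\<Sum>i=1..m. w i * cinner (\<phi> i) (u j)) = 0"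
        using w(2) by (simp flip: cinner_sum_left cinner_scale_left)
      then have "cnj (\<Sum>i=1..m. w i * cinner (\<phi> i) (u j)) = 0" by simp
      then have "(\<Sum>i=1..m. cnj (w i) * cnj (cinner (\<phi> i) (u j))) = 0"
        by (simp only: cnj_sum complex_cnj_mult)
      then show "(\<Sum>i=1..m. of_real (sqrt t) * cnj (w i) * cnj (cinner (\<phi> i) (u j))) = 0"
        by (simp add: mult.assoc flip: sum_distrib_left)
    qed (use norm zero True in simp_all)
  qed
qed

text \<open>
  The operator depends only on the Gram matrix of the coordinate columns
  \<open>i \<mapsto> \<langle>\<phi>\<^sub>i, u\<^sub>j\<rangle>\<close>, which are orthogonal with squared norms \<open>l j\<close>. Columns \<open>p\<close> and \<open>q\<close> are
  replaced by columns of the new lengths that are still orthogonal to the others.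
\<close>

lemma move_eigenvalues:
  fixes \<phi> :: "nat \<Rightarrow> complex^'n"
  assumes T: "eigensystem (frame_operator m \<phi>) u l" and m: "CARD('n) \<le> m"
    and pq: "p \<in> {1..CARD('n)}" "q \<in> {1..CARD('n)}" "p \<noteq> q" and t: "0 \<le> t" "t < l p"
  obtains \<psi> where "eigensystem (frame_operator m \<psi>) u (l(p := l p - t, q := l q + t))"
    "\<And>i. i \<in> {1..m} \<Longrightarrow> norm (\<phi> i - \<psi> i) \<le> 2 * sqrt t"
proof -
  note u = eigensystem_orthonormal[OF T]
  define b where "b i j = cinner (\<phi> i) (u j)" for i j
  have gram: "(\<Sum>i=1..m. b i k * cnj (b i j)) = (if j = k then complex_of_real (l j) else 0)"
    if "j \<in> {1..CARD('n)}" "k \<in> {1..CARD('n)}" for j k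
    using eigensystem_iff_gram[OF u, THEN iffD1, OF T] that by (simp add: b_def)
  obtain z where z: "(\<Sum>i=1..m. (cmod (z i))\<^sup>2) = l q + t"
      "(\<Sum>i=1..m. (cmod (z i - b i q))\<^sup>2) \<le> t"
      "\<And>j. j \<in> {1..CARD('n)} \<Longrightarrow> j \<noteq> q \<Longrightarrow> (\<Sum>i=1..m. z i * cnj (b i j)) = 0"
    using increase_column[OF T m pq(2) t(1)] unfolding b_def by blast
  have z': "(\<Sum>i=1..m. b i j * cnj (z i)) = 0" if "j \<in> {1..CARD('n)}" "j \<noteq> q" for j
  proof -
    have "(\<Sum>i=1..m. b i j * cnj (z i)) = cnj (\<Sum>i=1..m. z i * cnj (b i j))"
      by (simp add: mult.commute)
    also have "\<dots> = 0" by (simp only: z(3)[OF that] complex_cnj_zero)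
    finally show ?thesis .
  qed
  have zz: "(\<Sum>i=1..m. z i * cnj (z i)) = complex_of_real (l q + t)"
    unfolding mult_cnj_cmod z(1)[symmetric] by simp
  have lp: "(\<Sum>i=1..m. (cmod (b i p))\<^sup>2) = l p"
    using eigenvalue_eq[OF T pq(1)] by (simp add: b_def cmod_cinner_commute)
  define s where "s = sqrt ((l p - t) / l p)"
  note scaled = rescale_column[of "\<lambda>i. b i p" m "l p" "l p - t", OF lp, folded s_def]
  have ss: "(\<Sum>i=1..m. of_real s * b i p * cnj (of_real s * b i p)) = complex_of_real (l p - t)"
    unfolding mult_cnj_cmod using scaled(1) t by (simp flip: of_real_power of_real_sum)
  define \<psi> where "\<psi> i = \<phi> i + (of_real s * b i p - b i p) *s u p + (z i - b i q) *s u q" for i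
  have coord: "cinner (\<psi> i) (u j) = (if j = p then of_real s * b i p else if j = q then z i else b i j)"
    if "j \<in> {1..CARD('n)}" for i j
    using orthonormalD[OF u pq(1) that] orthonormalD[OF u pq(2) that] pq(3)
    by (auto simp: \<psi>_def cinner_simps b_def)
  have "eigensystem (frame_operator m \<psi>) u (l(p := l p - t, q := l q + t))"
    unfolding eigensystem_iff_gram[OF u]
  proof (intro ballI)
    fix j k assume jk: "j \<in> {1..CARD('n)}" "k \<in> {1..CARD('n)}"
    have "(\<Sum>i=1..m. cinner (\<psi> i) (u k) * cnj (cinner (\<psi> i) (u j))) =
      (\<Sum>i=1..m. (if k = p then of_real s * b i p else if k = q then z i else b i k) *
         cnj (if j = p then of_real s * b i p else if j = q then z i else b i j))" (is "_ = ?G")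
      by (simp only: coord[OF jk(1)] coord[OF jk(2)])
    also have "?G = (if j = k then complex_of_real ((l(p := l p - t, q := l q + t)) j) else 0)"
    proof -
      have pull: "(\<Sum>i\<in>I. of_real s * g i * h i) = of_real s * (\<Sum>i\<in>I. g i * h i)"
        "(\<Sum>i\<in>I. h i * (of_real s * g i)) = of_real s * (\<Sum>i\<in>I. h i * g i)"
        for g h :: "nat \<Rightarrow> complex" and I
        by (simp_all add: sum_distrib_left mult.assoc mult.left_commute)
      consider "j = k" "j = p" | "j = k" "j = q" | "j = k" "j \<noteq> p" "j \<noteq> q"
        | "j \<noteq> k" "k = q" | "j \<noteq> k" "j = q" | "j \<noteq> k" "j \<noteq> q" "k \<noteq> q"
        by blast
      then show ?thesis
      proof cases
        case 1
        then show ?thesis using ss pq(3) by simp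
      next
        case 2
        then show ?thesis using zz pq(3) by simp
      next
        case 3
        then show ?thesis using gram[OF jk] by simp
      next
        case 4
        then show ?thesis using z(3)[OF jk(1)] pq(3) by (cases "j = p") (simp_all add: pull)
      next
        case 5
        then show ?thesis using z'[OF jk(2)] pq(3) by (cases "k = p") (simp_all add: pull)
      next
        case 6
        then show ?thesis using gram[OF jk] by (cases "j = p"; cases "k = p") (simp_all add: pull)
      qed
    qed
    finally show "(\<Sum>i=1..m. cinner (\<psi> i) (u k) * cnj (cinner (\<psi> i) (u j))) =
      (if j = k then complex_of_real ((l(p := l p - t, q := l q + t)) j) else 0)" .
  qed
  moreover have "norm (\<phi> i - \<psi> i) \<le> 2 * sqrt t" if i: "i \<in> {1..m}" for i
  proof -
    have small: "cmod (h i) \<le> sqrt t" if "(\<Sum>i=1..m. (cmod (h i))\<^sup>2) \<le> t" for h :: "nat \<Rightarrow> complex"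
    proof -
      have "(cmod (h i))\<^sup>2 \<le> (\<Sum>i=1..m. (cmod (h i))\<^sup>2)"
        by (rule member_le_sum) (use i in auto)
      then show ?thesis using that by (intro real_le_rsqrt) linarith
    qed
    have "norm (\<phi> i - \<psi> i) = norm (\<psi> i - \<phi> i)" by (rule norm_minus_commute)
    also have "\<psi> i - \<phi> i = (of_real s * b i p - b i p) *s u p + (z i - b i q) *s u q"
      unfolding \<psi>_def by (simp only: add.assoc add_diff_cancel_left')
    also have "norm \<dots> \<le> cmod (of_real s * b i p - b i p) + cmod (z i - b i q)"
      using norm_triangle_ineq[of "(of_real s * b i p - b i p) *s u p" "(z i - b i q) *s u q"]
      by (simp only: norm_scale orthonormal_norm[OF u pq(1)] orthonormal_norm[OF u pq(2)] mult_1_right)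
    also have "\<dots> \<le> sqrt t + sqrt t"
      using small[of "\<lambda>i. of_real s * b i p - b i p"] small[of "\<lambda>i. z i - b i q"] scaled(2) z(2) t
      by (intro add_mono) auto
    finally show ?thesis by simp
  qed
  ultimately show thesis by (rule that)
qed

lemma strictly_convex_exchange:
  assumes f: "strictly_convex_on I f" and xy: "x \<in> I" "y \<in> I" "0 < t" "t < x - y"
  shows "f (x - t) + f (y + t) < f x + f y"
proof -
  define s where "s = t / (x - y)"
  have s: "0 < s" "s < 1" "s * (x - y) = t" using xy by (simp_all add: s_def)
  have *: "x \<noteq> y" using xy by auto
  have st: "x - t = (1 - s) * x + s * y" "y + t = (1 - s) * y + s * x"
    using s(3) by (simp_all add: algebra_simps)
  have "f ((1 - s) * x + s * y) < (1 - s) * f x + s * f y"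
    "f ((1 - s) * y + s * x) < (1 - s) * f y + s * f x"
    using f xy(1,2) s(1,2) * unfolding strictly_convex_on_def by metis+
  then show ?thesis unfolding st by (simp add: algebra_simps)
qed

text \<open>
  Moving two different eigenvalues a little towards each other keeps the trace and decreases
  the potential.
\<close>

lemma local_minimizer_total_eigenvalues:
  fixes \<phi> :: "nat \<Rightarrow> complex^'n"
  assumes f: "strictly_convex_on {0..} f" and m: "CARD('n) \<le> m"
    and min: "local_minimizer (frame_potential f m) (frames_total m c) (vector_vector_dist m) \<phi>"
    and T: "eigensystem (frame_operator m \<phi>) u l"
    and pq: "p \<in> {1..CARD('n)}" "q \<in> {1..CARD('n)}"
  shows "l p \<le> l q"
proof (rule ccontr)
  assume "\<not> l p \<le> l q"
  then have less: "l q < l p" and ne: "p \<noteq> q" by auto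
  obtain \<epsilon> where \<epsilon>: "0 < \<epsilon>"
    and le: "\<And>\<psi>. \<psi> \<in> frames_total m c \<Longrightarrow> vector_vector_dist m \<phi> \<psi> < \<epsilon> \<Longrightarrow>
      frame_potential f m \<phi> \<le> frame_potential f m \<psi>"
    using min by (auto simp: local_minimizer_def)
  have q0: "0 \<le> l q" by (rule eigenvalue_nonneg[OF T pq(2)])
  \<comment> \<open>The second bound turns the displacement \<open>2 * sqrt t\<close> of the frame vectors into \<open>\<epsilon> / 2\<close>.\<close>
  define t where "t = min ((l p - l q) / 2) ((\<epsilon> / 4)\<^sup>2)"
  have t: "0 < t" "t < l p - l q" "t \<le> (\<epsilon> / 4)\<^sup>2"
    using less \<epsilon> by (auto simp: t_def min_less_iff_disj)
  have "t < l p" using t(2) q0 by simp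
  let ?l = "l(p := l p - t, q := l q + t)"
  obtain \<psi> where \<psi>: "eigensystem (frame_operator m \<psi>) u ?l"
    "\<And>i. i \<in> {1..m} \<Longrightarrow> norm (\<phi> i - \<psi> i) \<le> 2 * sqrt t"
    using move_eigenvalues[OF T m pq ne less_imp_le[OF t(1)] \<open>t < l p\<close>] by blast
  have sum_l: "(\<Sum>j=1..CARD('n). F (?l j)) + (F (l p) + F (l q)) =
      (\<Sum>j=1..CARD('n). F (l j)) + (F (l p - t) + F (l q + t))" for F :: "real \<Rightarrow> real"
  proof -
    have "(\<Sum>j\<in>{1..CARD('n)} - {p} - {q}. F (?l j)) = (\<Sum>j\<in>{1..CARD('n)} - {p} - {q}. F (l j))"
      by (intro sum.cong) auto
    then show ?thesis
      using sum_remove2[OF finite_atLeastAtMost pq ne, of "\<lambda>j. F (?l j)"]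
        sum_remove2[OF finite_atLeastAtMost pq ne, of "\<lambda>j. F (l j)"] ne by simp
  qed
  have "sqrt t \<le> \<epsilon> / 4"
    using t(3) \<epsilon> by (intro real_le_lsqrt) auto
  then have close: "norm (\<phi> i - \<psi> i) < \<epsilon>" if "i \<in> {1..m}" for i
    using \<psi>(2)[OF that] \<epsilon> by linarith
  have "1 \<le> m" using m by (metis One_nat_def Suc_leI order_trans zero_less_card_finite)
  then have "vector_vector_dist m \<phi> \<psi> < \<epsilon>"
    unfolding vector_vector_dist_def using close by (subst Max_less_iff) auto
  moreover have "\<psi> \<in> frames_total m c"
    using min eigenvalue_sum[OF T] eigenvalue_sum[OF \<psi>(1)] sum_l[of "\<lambda>x. x"]
    by (simp add: local_minimizer_def frames_total_def)
  ultimately have "frame_potential f m \<phi> \<le> frame_potential f m \<psi>"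
    by (intro le)
  then have "(\<Sum>j=1..CARD('n). f (l j)) \<le> (\<Sum>j=1..CARD('n). f (?l j))"
    by (simp only: frame_potential_def tr_fun_eigensystem[OF T] tr_fun_eigensystem[OF \<psi>(1)])
  then show False
    using sum_l[of f] strictly_convex_exchange[OF f, of "l p" "l q" t] t q0 less by simp
qed

lemma local_minimizer_total:
  fixes \<phi> :: "nat \<Rightarrow> complex^'n"
  assumes f: "strictly_convex_on {0..} f" and m: "CARD('n) \<le> m" and c: "0 < c"
    and min: "local_minimizer (frame_potential f m) (frames_total m c) (vector_vector_dist m) \<phi>"
  shows "tight_frame_for {1..m} \<phi> UNIV"
    and "global_minimizer (frame_potential f m) (frames_total m c) \<phi>"
proof -
  obtain u l where T: "eigensystem (frame_operator m \<phi>) u l"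
    using sorted_eigensystem_exists frame_operator_selfadjoint by metis
  have \<phi>: "\<phi> \<in> frames_total m c" using min by (simp add: local_minimizer_def)
  define \<alpha> where "\<alpha> = c / real CARD('n)"
  have \<alpha>: "0 < \<alpha>" using c by (simp add: \<alpha>_def)
  have sum_l: "(\<Sum>j=1..CARD('n). l j) = c"
    using eigenvalue_sum[OF T] \<phi> by (simp add: frames_total_def)
  have l: "l j = \<alpha>" if j: "j \<in> {1..CARD('n)}" for j
  proof -
    have "l k = l j" if "k \<in> {1..CARD('n)}" for k
      using local_minimizer_total_eigenvalues[OF f m min T] that j by (meson antisym)
    then have "(\<Sum>k=1..CARD('n). l k) = real CARD('n) * l j" by simp
    then show ?thesis using sum_l by (simp add: \<alpha>_def field_simps)
  qed
  show "tight_frame_for {1..m} \<phi> UNIV"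
    unfolding tight_frame_for_def
  proof (intro conjI ballI exI[of _ \<alpha>])
    fix x :: "complex^'n"
    have "complex_of_real (\<Sum>i=1..m. (cmod (cinner x (\<phi> i)))\<^sup>2) =
        of_real (\<Sum>j=1..CARD('n). l j * (cmod (cinner x (u j)))\<^sup>2)"
      unfolding frame_quad[symmetric] eigensystem_quad[OF T] ..
    also have "(\<Sum>j=1..CARD('n). l j * (cmod (cinner x (u j)))\<^sup>2) = \<alpha> * (norm x)\<^sup>2"
      by (simp add: l parseval[OF eigensystem_orthonormal[OF T]] sum_distrib_left)
    finally show "(\<Sum>i=1..m. (cmod (cinner x (\<phi> i)))\<^sup>2) = \<alpha> * (norm x)\<^sup>2"
      unfolding of_real_eq_iff .
  qed (simp_all add: \<alpha>)
  have "frame_potential f m \<phi> \<le> frame_potential f m \<psi>" if \<psi>: "\<psi> \<in> frames_total m c"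
    for \<psi> :: "nat \<Rightarrow> complex^'n"
  proof -
    obtain v k where V: "eigensystem (frame_operator m \<psi>) v k"
      using sorted_eigensystem_exists frame_operator_selfadjoint by metis
    have sum_k: "(\<Sum>j=1..CARD('n). k j) = c"
      using eigenvalue_sum[OF V] \<psi> by (simp add: frames_total_def)
    have \<alpha>_sum: "(\<Sum>j=1..CARD('n). \<alpha>) = c" by (simp add: \<alpha>_def)
    have "(\<Sum>j=1..CARD('n). f \<alpha>) \<le> (\<Sum>j=1..CARD('n). f (k j))"
    proof (cases "\<exists>j\<in>{1..CARD('n)}. k j \<noteq> \<alpha>")
      case True
      then have "(\<Sum>j=1..CARD('n). f \<alpha>) < (\<Sum>j=1..CARD('n). f (k j))"
        using sum_convex_less[OF f, of "CARD('n)" "\<lambda>_. \<alpha>" k] \<alpha> eigenvalue_nonneg[OF V] \<alpha>_sum sum_k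
        by (simp add: monotone_on_def)
      then show ?thesis by simp
    qed simp
    then show ?thesis
      by (simp add: frame_potential_def tr_fun_eigensystem[OF T] tr_fun_eigensystem[OF V] l)
  qed
  then show "global_minimizer (frame_potential f m) (frames_total m c) \<phi>"
    using \<phi> by (simp add: global_minimizer_def)
qed

theorem mainTheorem2:
  fixes m :: nat and f :: "real \<Rightarrow> real" and c :: real and a :: "nat \<Rightarrow> real"
  assumes "CARD('n::finite) \<le> m"
    and "\<And>x. 0 \<le> x \<Longrightarrow> 0 \<le> f x"
    and "mono_on {0..} f"
    and "strictly_convex_on {0..} f"
    and "0 < c"
    and "antimono_on {1..m} a"
    and "\<And>i. i \<in> {1..m} \<Longrightarrow> 0 < a i"
  shows
    "(\<forall>\<phi> :: nat \<Rightarrow> complex^'n.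
        local_minimizer (frame_potential f m) (frames_total m c) (vector_vector_dist m) \<phi> \<longrightarrow>
          tight_frame_for {1..m} \<phi> UNIV \<and>
          global_minimizer (frame_potential f m) (frames_total m c) \<phi>) \<and>
     (\<forall>\<phi> :: nat \<Rightarrow> complex^'n.
        \<phi> \<in> frames_norms m a \<and>
        local_minimizer (tr_fun f) (frame_operators_norms m a) operator_dist
          (frame_operator m \<phi>) \<longrightarrow>
          (let r = irregularity CARD('n) m a in
             \<exists>e :: nat \<Rightarrow> complex^'n. orthonormal_basis e \<and>
               (\<forall>i\<in>{1..r}. \<phi> i = sqrt (a i) *\<^sub>R e i) \<and>
               tight_frame_for {r+1..m} \<phi> (vec.span (e ` {r+1..CARD('n)}))) \<and>
          global_minimizer (tr_fun f) (frame_operators_norms m a) (frame_operator m \<phi>))"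
proof (intro conjI allI impI)
  fix \<phi> :: "nat \<Rightarrow> complex^'n"
  assume "local_minimizer (frame_potential f m) (frames_total m c) (vector_vector_dist m) \<phi>"
  then show "tight_frame_for {1..m} \<phi> UNIV"
    "global_minimizer (frame_potential f m) (frames_total m c) \<phi>"
    using local_minimizer_total[OF assms(4,1,5)] by blast+
next
  fix \<phi> :: "nat \<Rightarrow> complex^'n"
  assume "\<phi> \<in> frames_norms m a \<and>
    local_minimizer (tr_fun f) (frame_operators_norms m a) operator_dist (frame_operator m \<phi>)"
  then have \<phi>: "\<phi> \<in> frames_norms m a"
    and min: "local_minimizer (tr_fun f) (frame_operators_norms m a) operator_dist (frame_operator m \<phi>)"
    by auto
  have ns: "norm_sequence CARD('n) m a"
    using assms(1,6,7) by (simp add: norm_sequence_def Suc_leI)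
  have frame: "\<exists>u l. prescribed_frame m a \<psi> u l" if "\<psi> \<in> frames_norms m a"
    for \<psi> :: "nat \<Rightarrow> complex^'n"
  proof -
    obtain u l where "eigensystem (frame_operator m \<psi>) u l" "antimono_on {1..CARD('n)} l"
      using sorted_eigensystem_exists[OF frame_operator_selfadjoint[of m \<psi>]] by blast
    then show ?thesis
      using ns that by (auto simp: prescribed_frame_def prescribed_frame_axioms_def)
  qed
  obtain u l where "prescribed_frame m a \<phi> u l" using frame[OF \<phi>] by blast
  then interpret prescribed_frame m a \<phi> u l .
  interpret optimal_frame m a \<phi> u l
    by unfold_locales (rule local_minimizer_optimal[OF assms(4) min])
  show "let r = irregularity CARD('n) m a in
     \<exists>e :: nat \<Rightarrow> complex^'n. orthonormal_basis e \<and>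
       (\<forall>i\<in>{1..r}. \<phi> i = sqrt (a i) *\<^sub>R e i) \<and>
       tight_frame_for {r+1..m} \<phi> (vec.span (e ` {r+1..CARD('n)}))"
    unfolding Let_def r_def[symmetric] orthonormal_basis_iff
    using e_orthonormal phi_eq tight_rest by blast
  have "tr_fun f (frame_operator m \<phi>) \<le> tr_fun f (frame_operator m \<psi>)"
    if \<psi>: "\<psi> \<in> frames_norms m a" for \<psi> :: "nat \<Rightarrow> complex^'n"
  proof -
    obtain v k where "prescribed_frame m a \<psi> v k" using frame[OF \<psi>] by blast
    then have "(\<Sum>j=1..CARD('n). f (optimal j)) \<le> tr_fun f (frame_operator m \<psi>)"
      using assms(4) by (rule prescribed_frame.optimal_le)
    then show ?thesis by (simp add: tr_fun_eigensystem[OF S] opt)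
  qed
  then show "global_minimizer (tr_fun f) (frame_operators_norms m a) (frame_operator m \<phi>)"
    using \<phi> by (auto simp: global_minimizer_def frame_operators_norms_def)
qed

end
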